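(* Let $P$ be a subgroup of $I_K(\mathfrak{n})$ with $P_{K,1}(\mathfrak{n})\subseteq P\subseteq P_K(\mathfrak{n})$ and let $\Gamma$ be a subgroup of $\mathrm{SL}_2(\mathbb{Z})$. The map $\phi_\Gamma:\mathcal{Q}_N(d_K)/\sim_\Gamma\to I_K(\mathfrak{n})/P$, $[Q]\mapsto[[\omega_Q,1]]$, is a well-defined bijection if and only if $\Gamma$ satisfies property (P): for every $Q\in\mathcal{Q}_N(d_K)$ and every $\gamma\in\mathrm{SL}_2(\mathbb{Z})$ with $Q^{\gamma^{-1}}\in\mathcal{Q}_N(d_K)$, one has $j(\gamma,\omega_Q)\mathcal{O}_K\in P$ if and only if $\gamma\in\Gamma\cdot I_{\omega_Q}$. In that case $\mathcal{Q}_N(d_K)/\sim_\Gamma$ acquires (by transport of structure via $\phi_\Gamma$) a group structure isomorphic to $I_K(\mathfrak{n})/P$.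
   Context: Let $K$ be an imaginary quadratic field with discriminant $d_K$ and ring of integers $\mathcal{O}_K$. Let $N$ be a positive integer and $\mathfrak{n}=N\mathcal{O}_K$. $I_K(\mathfrak{n})$ denotes the group of fractional ideals of $K$ relatively prime to $\mathfrak{n}$, $P_K(\mathfrak{n})$ its subgroup of principal fractional ideals, and $P_{K,1}(\mathfrak{n})=\{\nu\mathcal{O}_K:\nu\in K^*,\ \nu\equiv^*1\pmod{\mathfrak{n}}\}$, where $\equiv^*$ is multiplicative congruence. $\mathcal{Q}(d_K)$ is the set of primitive positive definite binary quadratic forms $ax^2+bxy+cy^2\in\mathbb{Z}[x,y]$ with $b^2-4ac=d_K$, and $\mathcal{Q}_N(d_K)=\{ax^2+bxy+cy^2\in\mathcal{Q}(d_K):\gcd(N,a)=1\}$. For $Q=ax^2+bxy+cy^2\in\mathcal{Q}(d_K)$, $\omega_Q=(-b+\sqrt{d_K})/(2a)\in\mathbb{H}$ and $[\omega_Q,1]=\mathbb{Z}\omega_Q+\mathbb{Z}$ (a fractional ideal of $K$). For $\gamma\in\mathrm{SL}_2(\mathbb{Z})$, $Q^\gamma(x,y)=Q(\gamma\,(x,y)^T)$. For a subgroup $\Gamma\subseteq\mathrm{SL}_2(\mathbb{Z})$, the relation $\sim_\Gamma$ on $\mathcal{Q}_N(d_K)$ is: $Q\sim_\Gamma Q'$ iff $Q'=Q^\gamma$ for some $\gamma\in\Gamma$. For $\gamma=\begin{bmatrix}a&b\\c&d\end{bmatrix}\in\mathrm{SL}_2(\mathbb{Z})$ and $\tau\in\mathbb{H}$,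 $j(\gamma,\tau)=c\tau+d$. $I_{\omega}$ denotes the isotropy subgroup of $\omega\in\mathbb{H}$ in $\mathrm{SL}_2(\mathbb{Z})$ under the action by fractional linear transformations. *)

theory Defs
  imports "HOL-Analysis.Analysis" "HOL-Algebra.Coset" "HOL-Computational_Algebra.Squarefree"
begin

section \<open>The imaginary quadratic field K, embedded in the complex numbers\<close>

text \<open>d is a fundamental discriminant of an imaginary quadratic field.\<close>
definition imag_quad_disc :: "int \<Rightarrow> bool" where
  "imag_quad_disc d \<longleftrightarrow> d < 0 \<and>
     ((d mod 4 = 1 \<and> squarefree d) \<or>
      (d mod 4 = 0 \<and> (d div 4) mod 4 \<in> {2, 3} \<and> squarefree (d div 4)))"

text \<open>The square root of d_K in the upper half plane.\<close>
definition sqrtD :: "int \<Rightarrow> complex" where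
  "sqrtD d = \<i> * complex_of_real (sqrt (- real_of_int d))"

definition Kfield :: "int \<Rightarrow> complex set" where
  "Kfield d = {of_rat x + of_rat y * sqrtD d | x y. True}"

text \<open>Ring of integers O_K = Z + Z (d_K + sqrt d_K)/2.\<close>
definition OK :: "int \<Rightarrow> complex set" where
  "OK d = {of_int m + of_int n * ((of_int d + sqrtD d) / 2) | m n. True}"

text \<open>O_K-submodule of K generated by a set S.\<close>
definition OK_span :: "int \<Rightarrow> complex set \<Rightarrow> complex set" where
  "OK_span d S = {x. \<exists>F f. finite F \<and> F \<subseteq> S \<and> (\<forall>s\<in>F. f s \<in> OK d) \<and>
                          x = (\<Sum>s\<in>F. f s * s)}"

text \<open>Fractional ideals: nonzero finitely generated O_K-submodules of K.\<close>
definition frac_ideal :: "int \<Rightarrow> complex set \<Rightarrow> bool" where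
  "frac_ideal d M \<longleftrightarrow> (\<exists>S. finite S \<and> S \<subseteq> Kfield d \<and> M = OK_span d S) \<and> M \<noteq> {0}"

definition integral_ideal :: "int \<Rightarrow> complex set \<Rightarrow> bool" where
  "integral_ideal d M \<longleftrightarrow> frac_ideal d M \<and> M \<subseteq> OK d"

definition ideal_mult :: "int \<Rightarrow> complex set \<Rightarrow> complex set \<Rightarrow> complex set" where
  "ideal_mult d M M' = OK_span d {x * y | x y. x \<in> M \<and> y \<in> M'}"

definition ideal_add :: "complex set \<Rightarrow> complex set \<Rightarrow> complex set" where
  "ideal_add M M' = {x + y | x y. x \<in> M \<and> y \<in> M'}"

text \<open>The principal fractional ideal nu O_K.\<close>
definition principal :: "int \<Rightarrow> complex \<Rightarrow> complex set" where
  "principal d \<nu> = {\<nu> * x | x. x \<in> OK d}"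

text \<open>An integral ideal A is coprime to n = N O_K iff A + n = O_K.\<close>
definition coprime_n :: "int \<Rightarrow> nat \<Rightarrow> complex set \<Rightarrow> bool" where
  "coprime_n d N A \<longleftrightarrow> ideal_add A (principal d (of_nat N)) = OK d"

text \<open>I_K(n): fractional ideals relatively prime to n, i.e. quotients A B^{-1}
  (M B = A) of integral ideals A, B coprime to n.\<close>
definition IK :: "int \<Rightarrow> nat \<Rightarrow> complex set set" where
  "IK d N = {M. frac_ideal d M \<and>
     (\<exists>A B. integral_ideal d A \<and> integral_ideal d B \<and> coprime_n d N A \<and> coprime_n d N B \<and>
            ideal_mult d M B = A)}"

definition IK_group :: "int \<Rightarrow> nat \<Rightarrow> complex set monoid" where
  "IK_group d N = \<lparr>carrier = IK d N, mult = ideal_mult d, one = OK d\<rparr>"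

text \<open>P_K(n): principal fractional ideals in I_K(n).\<close>
definition PK :: "int \<Rightarrow> nat \<Rightarrow> complex set set" where
  "PK d N = {principal d \<nu> | \<nu>. \<nu> \<in> Kfield d \<and> \<nu> \<noteq> 0 \<and> principal d \<nu> \<in> IK d N}"

text \<open>P_{K,1}(n): nu O_K with nu = alpha/beta, alpha, beta in O_K, alpha O_K and
  beta O_K coprime to n, alpha \<equiv> beta mod n (multiplicative congruence nu \<equiv>* 1 mod n).\<close>
definition PK1 :: "int \<Rightarrow> nat \<Rightarrow> complex set set" where
  "PK1 d N = {principal d \<nu> | \<nu>. \<nu> \<in> Kfield d \<and> \<nu> \<noteq> 0 \<and>
      (\<exists>\<alpha> \<beta>. \<alpha> \<in> OK d \<and> \<beta> \<in> OK d \<and> \<beta> \<noteq> 0 \<and> \<nu> = \<alpha> / \<beta> \<and>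
             coprime_n d N (principal d \<alpha>) \<and> coprime_n d N (principal d \<beta>) \<and>
             \<alpha> - \<beta> \<in> principal d (of_nat N))}"

section \<open>Binary quadratic forms\<close>

text \<open>A form a x^2 + b x y + c y^2 is represented by its coefficient triple (a, b, c).\<close>
type_synonym qform = "int \<times> int \<times> int"

definition Qd :: "int \<Rightarrow> qform set" where
  "Qd d = {(a, b, c). gcd a (gcd b c) = 1 \<and> a > 0 \<and> b\<^sup>2 - 4 * a * c < 0 \<and> b\<^sup>2 - 4 * a * c = d}"

definition QN :: "int \<Rightarrow> nat \<Rightarrow> qform set" where
  "QN d N = {(a, b, c). (a, b, c) \<in> Qd d \<and> gcd (int N) a = 1}"

definition omega :: "int \<Rightarrow> qform \<Rightarrow> complex" where
  "omega d Q = (case Q of (a, b, c) \<Rightarrow> (- of_int b + sqrtD d) / (2 * of_int a))"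

text \<open>The lattice [omega, 1] = Z omega + Z.\<close>
definition latt :: "complex \<Rightarrow> complex set" where
  "latt \<omega> = {of_int m * \<omega> + of_int n | m n. True}"

section \<open>SL_2(Z)\<close>

definition SL2Z :: "(int^2^2) monoid" where
  "SL2Z = \<lparr>carrier = {A. det A = 1}, mult = (**), one = mat 1\<rparr>"

text \<open>Q^gamma (x, y) = Q(gamma (x, y)^T), written out in coefficients.\<close>
definition form_act :: "qform \<Rightarrow> int^2^2 \<Rightarrow> qform" where
  "form_act Q \<gamma> = (case Q of (a, b, c) \<Rightarrow>
     (let p = \<gamma>$1$1; q = \<gamma>$1$2; r = \<gamma>$2$1; t = \<gamma>$2$2 in
      (a * p\<^sup>2 + b * p * r + c * r\<^sup>2,
       2 * a * p * q + b * (p * t + q * r) + 2 * c * r * t,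
       a * q\<^sup>2 + b * q * t + c * t\<^sup>2)))"

definition sl2_inv :: "int^2^2 \<Rightarrow> int^2^2" where
  "sl2_inv \<gamma> = (\<chi> i j. if i = 1 \<and> j = 1 then \<gamma>$2$2 else if i = 2 \<and> j = 2 then \<gamma>$1$1
                       else - \<gamma>$i$j)"

definition jfac :: "int^2^2 \<Rightarrow> complex \<Rightarrow> complex" where
  "jfac \<gamma> \<tau> = of_int (\<gamma>$2$1) * \<tau> + of_int (\<gamma>$2$2)"

definition moebius :: "int^2^2 \<Rightarrow> complex \<Rightarrow> complex" where
  "moebius \<gamma> \<tau> = (of_int (\<gamma>$1$1) * \<tau> + of_int (\<gamma>$1$2)) / jfac \<gamma> \<tau>"

definition isotropy :: "complex \<Rightarrow> (int^2^2) set" where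
  "isotropy \<omega> = {\<gamma> \<in> carrier SL2Z. moebius \<gamma> \<omega> = \<omega>}"

text \<open>The relation \<sim>_Gamma on Q_N(d_K).\<close>
definition form_rel :: "int \<Rightarrow> nat \<Rightarrow> (int^2^2) set \<Rightarrow> (qform \<times> qform) set" where
  "form_rel d N \<Gamma> = {(Q, Q'). Q \<in> QN d N \<and> Q' \<in> QN d N \<and> (\<exists>\<gamma>\<in>\<Gamma>. Q' = form_act Q \<gamma>)}"

text \<open>The map phi_Gamma: [Q] \<mapsto> [[omega_Q, 1]] (class of the lattice modulo P).\<close>
definition phi :: "int \<Rightarrow> nat \<Rightarrow> complex set set \<Rightarrow> qform set \<Rightarrow> complex set set" where
  "phi d N P X = the_elem ((\<lambda>Q. P #>\<^bsub>IK_group d N\<^esub> latt (omega d Q)) ` X)"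

text \<open>Property (P).\<close>
definition property_P :: "int \<Rightarrow> nat \<Rightarrow> complex set set \<Rightarrow> (int^2^2) set \<Rightarrow> bool" where
  "property_P d N P \<Gamma> \<longleftrightarrow>
     (\<forall>Q \<in> QN d N. \<forall>\<gamma> \<in> carrier SL2Z. form_act Q (sl2_inv \<gamma>) \<in> QN d N \<longrightarrow>
        (principal d (jfac \<gamma> (omega d Q)) \<in> P \<longleftrightarrow>
         \<gamma> \<in> \<Gamma> <#>\<^bsub>SL2Z\<^esub> isotropy (omega d Q)))"

end

theory Submission
  imports Defs
begin

text \<open>
  For forms \<open>Q\<close>, \<open>Q'\<close> the lattices \<open>[\<omega>\<^sub>Q, 1]\<close> and \<open>[\<omega>\<^sub>Q\<^sub>', 1]\<close> are homothetic exactly when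
  \<open>\<omega>\<^sub>Q\<^sub>' = \<gamma> \<omega>\<^sub>Q\<close> for some \<open>\<gamma>\<close> in \<open>SL\<^sub>2(Z)\<close>, and then the ratio is \<open>j(\<gamma>, \<omega>\<^sub>Q)\<close>. So two forms have the
  same class modulo \<open>P\<close> iff some such \<open>\<gamma>\<close> has \<open>j(\<gamma>, \<omega>\<^sub>Q) O\<^sub>K\<close> in \<open>P\<close>, while they are \<open>\<Gamma>\<close>-equivalent iff
  \<open>\<gamma>\<close> can be moved into \<open>\<Gamma>\<close> by an element fixing \<open>\<omega>\<^sub>Q\<close>. Property (P) therefore says precisely that the
  fibres of \<open>Q \<mapsto> [[\<omega>\<^sub>Q, 1]]\<close> are the \<open>\<Gamma>\<close>-classes. Surjectivity needs no hypothesis on \<open>\<Gamma>\<close>: every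
  ideal prime to \<open>N\<close> is \<open>\<nu> [\<omega>\<^sub>Q, 1]\<close> with \<open>\<nu> \<equiv>\<^sup>* 1\<close> modulo \<open>N\<close>.
\<close>

section \<open>Lattices in the complex plane\<close>

text \<open>Property (P) speaks of each single \<gamma>, equality of classes only of the existence
  of some \<gamma>. The gap closes because two matrices that send \<open>omega d Q\<close> to the
  same point have factors \<open>jfac\<close> that rescale one invertible lattice to the same
  lattice, hence generate the same principal ideal. Invertibility is where the fundamental
  discriminant enters: it forces gcd(a, b, c) = 1, and Bezout then makes the product of
  [\<omega>, 1] with its conjugate principal. Coprimality to the modulus is carried by rational
  integers: one congruent to 1 modulo \<open>N\<close> inside the ideal, and another congruent to 1
  that clears its denominators. Forms are acted on from the right and points from the left, which is
  why the form with root \<gamma> \<omega> carries \<gamma>^-1. In surjectivity the second vector of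
  a lattice basis is the homothety ratio, so choosing it in a prescribed residue class is what puts
  the ratio into P_{K,1}.\<close>

definition zlat :: "complex \<Rightarrow> complex \<Rightarrow> complex set" where
  "zlat x y = {of_int m * x + of_int n * y | m n. True}"

lemma zlatI: "z = of_int m * x + of_int n * y \<Longrightarrow> z \<in> zlat x y"
  by (auto simp: zlat_def)

lemma zlatE:
  assumes "z \<in> zlat x y"
  obtains m n where "z = of_int m * x + of_int n * y"
  using assms by (auto simp: zlat_def)

lemma latt_eq_zlat: "latt w = zlat w 1"
  by (simp add: latt_def zlat_def)

lemma zlat_left: "x \<in> zlat x y" and zlat_right: "y \<in> zlat x y"
  by (rule zlatI[where m = 1 and n = 0], simp) (rule zlatI[where m = 0 and n = 1], simp)

lemma zlat_scale: "(*) c ` zlat x y = zlat (c * x) (c * y)"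
proof -
  have "c * (of_int m * x + of_int n * y) = of_int m * (c * x) + of_int n * (c * y)" for m n
    by (simp add: algebra_simps)
  then show ?thesis by (auto simp: zlat_def image_def) metis
qed

lemma zlat_subset:
  assumes "x \<in> zlat x' y'" "y \<in> zlat x' y'"
  shows "zlat x y \<subseteq> zlat x' y'"
proof
  fix z assume "z \<in> zlat x y"
  then obtain m n where z: "z = of_int m * x + of_int n * y" by (rule zlatE)
  obtain p q where p: "x = of_int p * x' + of_int q * y'" using assms(1) by (rule zlatE)
  obtain r s where r: "y = of_int r * x' + of_int s * y'" using assms(2) by (rule zlatE)
  show "z \<in> zlat x' y'"
    by (rule zlatI[where m = "m * p + n * r" and n = "m * q + n * s"])
       (simp add: z p r algebra_simps)
qed

lemma zlat_basis_change:
  fixes p q r s :: int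
  assumes "p * s - q * r = 1"
  shows "zlat (of_int p * x + of_int q * y) (of_int r * x + of_int s * y) = zlat x y"
    (is "zlat ?x ?y = _")
proof (intro antisym zlat_subset)
  have *: "of_int p * of_int s - of_int q * of_int r = (1 :: complex)"
    using assms by (metis of_int_1 of_int_diff of_int_mult)
  have "of_int s * ?x - of_int q * ?y = (of_int p * of_int s - of_int q * of_int r) * x"
    by (simp add: algebra_simps)
  then show "x \<in> zlat ?x ?y"
    by (intro zlatI[where m = s and n = "- q"]) (simp add: *)
  have "of_int p * ?y - of_int r * ?x = (of_int p * of_int s - of_int q * of_int r) * y"
    by (simp add: algebra_simps)
  then show "y \<in> zlat ?x ?y"
    by (intro zlatI[where m = "- r" and n = p]) (simp add: *)
qed (auto intro: zlatI)

text \<open>Comparison of imaginary parts, then of what remains. Identities inside a lattice [w, 1]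
  become integer equations this way.\<close>

lemma lin_indep_Im:
  fixes m n m' n' :: int
  assumes "Im w \<noteq> 0" "of_int m * w + of_int n = of_int m' * w + of_int n'"
  shows "m = m'" "n = n'"
proof -
  have "of_int m * Im w = of_int m' * Im w"
    using arg_cong[OF assms(2), of Im] by simp
  then show "m = m'" using assms(1) by simp
  then show "n = n'" using assms(2) by simp
qed

lemma Im_moebius:
  assumes "of_int r * w + of_int s \<noteq> 0"
  shows "Im ((of_int p * w + of_int q) / (of_int r * w + of_int s)) =
         of_int (p * s - q * r) * Im w / (cmod (of_int r * w + of_int s))\<^sup>2"
  by (subst Im_divide) (simp add: cmod_power2 algebra_simps)

text \<open>Each basis is an integer combination of the other, so the transition matrices are
  inverse to each other and have determinant 1 or -1; both points lying in the upper half plane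
  excludes -1.\<close>

lemma zlat_homothetic:
  assumes "Im w > 0" "Im w' > 0" and eq: "zlat w 1 = zlat (\<nu> * w') \<nu>"
  obtains p q r s :: int where "p * s - q * r = 1"
    "\<nu> = of_int r * w + of_int s" "\<nu> * w' = of_int p * w + of_int q"
proof -
  obtain p q where p: "\<nu> * w' = of_int p * w + of_int q * 1"
    using zlat_left[of "\<nu> * w'" \<nu>] unfolding eq[symmetric] by (rule zlatE)
  obtain r s where r: "\<nu> = of_int r * w + of_int s * 1"
    using zlat_right[of \<nu> "\<nu> * w'"] unfolding eq[symmetric] by (rule zlatE)
  obtain x y where x: "w = of_int x * (\<nu> * w') + of_int y * \<nu>"
    using zlat_left[of w 1] unfolding eq by (rule zlatE)
  obtain z u where z: "1 = of_int z * (\<nu> * w') + of_int u * \<nu>"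
    using zlat_right[of 1 w] unfolding eq by (rule zlatE)
  have nz: "\<nu> \<noteq> 0" using z by auto
  have "of_int 1 * w + of_int 0 = of_int (x * p + y * r) * w + of_int (x * q + y * s)"
    using x unfolding p unfolding r by (simp add: algebra_simps)
  from lin_indep_Im[OF _ this] assms(1) have e1: "x * p + y * r = 1" "x * q + y * s = 0"
    by auto
  have "of_int 0 * w + of_int 1 = of_int (z * p + u * r) * w + of_int (z * q + u * s)"
    using z unfolding p unfolding r by (simp add: algebra_simps)
  from lin_indep_Im[OF _ this] assms(1) have e2: "z * p + u * r = 0" "z * q + u * s = 1"
    by auto
  \<comment> \<open>Multiplicativity of the determinant for the two transition matrices, whose
    product is the identity.\<close>
  have "(x * u - y * z) * (p * s - q * r) =
        (x * p + y * r) * (z * q + u * s) - (x * q + y * s) * (z * p + u * r)"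
    by (simp add: algebra_simps)
  then have det: "(x * u - y * z) * (p * s - q * r) = 1" by (simp add: e1 e2)
  have "w' = (of_int p * w + of_int q) / (of_int r * w + of_int s)"
    using p r nz by (simp add: field_simps)
  with Im_moebius[of r w s p q] r nz
  have "Im w' = of_int (p * s - q * r) * Im w / (cmod \<nu>)\<^sup>2" by simp
  with assms nz have "p * s - q * r > 0"
    by (metis (no_types, lifting) mult_pos_pos of_int_0_less_iff zero_less_divide_iff
        zero_less_mult_iff zero_le_power2 not_less order.asym)
  with det have "p * s - q * r = 1" by (smt (verit) zmult_eq_1_iff)
  with that p r show ?thesis by simp
qed

section \<open>Congruences and coprime representatives of residue classes\<close>

lemma dvd_mult_minus_one:
  fixes n a b :: int
  assumes "n dvd a - 1" "n dvd b - 1" shows "n dvd a * b - 1"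
proof -
  have "a * b - 1 = a * (b - 1) + (a - 1)" by (simp add: algebra_simps)
  then show ?thesis using assms by (metis dvd_add dvd_mult)
qed

text \<open>\<open>v\<close> is moved within its class modulo \<open>n\<close> until it shares no
  prime with the first entry.\<close>

lemma coprime_lift:
  fixes u v n :: int
  assumes "gcd (gcd u v) n = 1" "n \<noteq> 0"
  obtains u' v' where "n dvd u' - u" "n dvd v' - v" "coprime u' v'"
proof -
  \<comment> \<open>Zero is divisible by every prime; \<open>n\<close> represents the same class and
    has only finitely many prime divisors.\<close>
  define u' where "u' = (if u = 0 then n else u)"
  have u': "u' \<noteq> 0" "n dvd u' - u"
    using assms(2) by (auto simp: u'_def)
  \<comment> \<open>A prime of \<open>u'\<close> divides exactly one of \<open>v\<close> and
    \<open>t * n\<close>: it divides \<open>t\<close> iff it does not divide \<open>v\<close>, and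
    if it divided both \<open>v\<close> and \<open>n\<close> it would divide the given gcd.\<close>
  define T where "T = {p \<in> prime_factors u'. \<not> p dvd v}"
  define t where "t = \<Prod>T"
  have fin: "finite T" by (simp add: T_def)
  have "coprime u' (v + t * n)"
  proof (rule ccontr)
    assume "\<not> coprime u' (v + t * n)"
    then have "\<not> is_unit (gcd u' (v + t * n))" by (simp add: is_unit_gcd_iff coprime_iff_gcd_eq_1)
    moreover have "gcd u' (v + t * n) \<noteq> 0" using u' by simp
    ultimately obtain p where p: "prime p" "p dvd gcd u' (v + t * n)"
      using prime_divisor_exists by blast
    then have pu: "p dvd u'" and pv: "p dvd v + t * n" by auto
    show False
    proof (cases "p dvd v")
      case False
      then have "p \<in> T" using p(1) pu u' by (auto simp: T_def in_prime_factors_iff)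
      then have "p dvd t" unfolding t_def using dvd_prodI[OF fin, of p "\<lambda>x. x"] by simp
      then show False using pv False by (simp add: dvd_add_left_iff)
    next
      case True
      then have "p dvd t * n" using pv by (simp add: dvd_add_right_iff)
      then consider "p dvd t" | "p dvd n" using p(1) prime_dvd_mult_iff by blast
      then show False
      proof cases
        case 1
        then obtain q where "q \<in> T" "p dvd q"
          using p(1) fin unfolding t_def by (metis prime_dvd_prod_iff)
        then have "p = q" using p(1) by (auto simp: T_def in_prime_factors_iff primes_dvd_imp_eq)
        then show False using \<open>q \<in> T\<close> True by (simp add: T_def)
      next
        case 2
        then have "p dvd u" using pu by (auto simp: u'_def split: if_splits)
        then have "p dvd gcd (gcd u v) n" using True 2 by simp
        then show False using assms(1) p(1) by (simp add: not_prime_unit)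
      qed
    qed
  qed
  then show ?thesis using u'(2) that[of u' "v + t * n"] by simp
qed

section \<open>Arithmetic of the quadratic field\<close>

text \<open>A common factor g gives d = g^2 D with D congruent to 0 or 1 modulo 4. Squarefreeness of
  d or d/4 makes g a unit, except when g = 2h with h a unit; then d/4 = D would be 0 or 1 modulo 4
  instead of 2 or 3.\<close>

lemma primitive_of_fundamental:
  fixes a b c :: int
  assumes "imag_quad_disc d" "b\<^sup>2 - 4 * a * c = d"
  shows "gcd a (gcd b c) = 1"
proof -
  define g where "g = gcd a (gcd b c)"
  obtain a' b' c' where abc: "a = g * a'" "b = g * b'" "c = g * c'"
    unfolding g_def by (metis dvd_def gcd_dvd1 gcd_dvd2 dvd_trans)
  define D where "D = b'\<^sup>2 - 4 * a' * c'"
  have dD: "d = g\<^sup>2 * D"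
    unfolding D_def assms(2)[symmetric] abc by (simp add: algebra_simps power2_eq_square)
  have D4: "D mod 4 \<in> {0, 1}"
  proof (cases "even b'")
    case True
    then obtain k where "b' = 2 * k" by (rule evenE)
    then have "D = 4 * (k\<^sup>2 - a' * c')" by (simp add: D_def power2_eq_square)
    then show ?thesis by simp
  next
    case False
    then obtain k where "b' = 2 * k + 1" by (rule oddE)
    then have "D = 4 * (k\<^sup>2 + k - a' * c') + 1"
      by (simp add: D_def power2_eq_square algebra_simps)
    then have "D mod 4 = 1" by presburger
    then show ?thesis by simp
  qed
  have "is_unit g"
  proof (cases "d mod 4 = 1")
    case True
    then have "squarefree d" using assms(1) by (auto simp: imag_quad_disc_def)
    then show ?thesis using dD unfolding squarefree_def by auto
  next
    case False
    then have d0: "d mod 4 = 0" "(d div 4) mod 4 \<in> {2, 3}" and sf: "squarefree (d div 4)"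
      using assms(1) by (auto simp: imag_quad_disc_def)
    show ?thesis
    proof (cases "even g")
      case True
      then obtain h where "g = 2 * h" by (rule evenE)
      then have h: "d div 4 = h\<^sup>2 * D" using dD by (simp add: power2_eq_square)
      then have "is_unit h" using sf unfolding squarefree_def by auto
      then have "h\<^sup>2 = 1" by (metis int_dvd_int_iff is_unit_power_iff power2_eq_1_iff zdvd1_eq
            abs_eq_iff' power_one)
      then show ?thesis using h D4 d0 by auto
    next
      case False
      then have "coprime (g\<^sup>2) 4"
        by (metis coprime_left_2_iff_odd coprime_commute coprime_power_left_iff
            coprime_power_right_iff numeral_Bit0_eq_double power2_eq_square
            numeral_times_numeral semiring_norm(13) semiring_norm(11))
      moreover have "g\<^sup>2 dvd 4 * (d div 4)" using dD d0 by (metis dvd_triv_left dvd_eq_mod_eq_0 dvd_mult_div_cancel)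
      ultimately have "g\<^sup>2 dvd d div 4" by (simp add: coprime_dvd_mult_right_iff)
      then show ?thesis using sf unfolding squarefree_def by auto
    qed
  qed
  then show ?thesis by (simp add: g_def)
qed

locale imag_quad_field =
  fixes d :: int
  assumes disc: "imag_quad_disc d"
begin

definition theta :: complex where "theta = (of_int d + sqrtD d) / 2"

text \<open>The norm of \<open>theta\<close>, whose trace is \<open>d\<close>.\<close>

definition enorm :: int where "enorm = (d * d - d) div 4"

lemma d_neg: "d < 0"
  using disc by (simp add: imag_quad_disc_def)

lemma enorm4: "4 * enorm = d * d - d"
proof -
  have "d mod 4 = 0 \<or> d mod 4 = 1" using disc by (auto simp: imag_quad_disc_def)
  then have "4 dvd d \<or> 4 dvd d - 1" by presburger
  then have "4 dvd d * (d - 1)" by auto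
  then show ?thesis unfolding enorm_def by (simp add: algebra_simps)
qed

lemma Re_sqrtD [simp]: "Re (sqrtD d) = 0" and Im_sqrtD: "Im (sqrtD d) = sqrt (- real_of_int d)"
  by (simp_all add: sqrtD_def)

lemma Im_sqrtD_pos [simp]: "Im (sqrtD d) > 0"
  using d_neg by (simp add: Im_sqrtD)

lemma sqrtD_sq: "sqrtD d * sqrtD d = of_int d"
  using d_neg by (simp add: sqrtD_def complex_eq_iff)

lemma Im_theta [simp]: "Im theta > 0"
  by (simp add: theta_def)

lemma theta_sq: "theta * theta = of_int d * theta - of_int enorm"
proof -
  have "4 * (of_int enorm :: complex) = of_int d * of_int d - of_int d"
    using arg_cong[OF enorm4, of "of_int :: int \<Rightarrow> complex"] by simp
  moreover have "4 * (theta * theta) = of_int d * of_int d + 2 * of_int d * sqrtD d + of_int d"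
    by (simp add: theta_def field_simps sqrtD_sq)
  moreover have "4 * (of_int d * theta) = 2 * of_int d * of_int d + 2 * of_int d * sqrtD d"
    by (simp add: theta_def field_simps)
  ultimately have "4 * (theta * theta) = 4 * (of_int d * theta - of_int enorm)"
    by (simp add: algebra_simps)
  then show ?thesis by (metis mult_cancel_left zero_neq_numeral)
qed

lemma OK_iff: "x \<in> OK d \<longleftrightarrow> (\<exists>m n. x = of_int m + of_int n * theta)"
  by (auto simp: OK_def theta_def)

lemma OK_I: "x = of_int m + of_int n * theta \<Longrightarrow> x \<in> OK d"
  by (auto simp: OK_iff)

lemma OK_E:
  assumes "x \<in> OK d"
  obtains m n where "x = of_int m + of_int n * theta"
  using assms by (auto simp: OK_iff)

lemma OK_of_int [simp]: "of_int m \<in> OK d"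
  by (rule OK_I[where n = 0]) simp

lemma OK_0 [simp]: "0 \<in> OK d" and OK_1 [simp]: "1 \<in> OK d"
  using OK_of_int[of 0] OK_of_int[of 1] by simp_all

lemma OK_theta [simp]: "theta \<in> OK d"
  by (rule OK_I[where m = 0 and n = 1]) simp

lemma OK_add [simp]: "x \<in> OK d \<Longrightarrow> y \<in> OK d \<Longrightarrow> x + y \<in> OK d"
proof (elim OK_E)
  fix m n m' n'
  assume "x = of_int m + of_int n * theta" "y = of_int m' + of_int n' * theta"
  then show "x + y \<in> OK d"
    by (intro OK_I[where m = "m + m'" and n = "n + n'"]) (simp add: algebra_simps)
qed

lemma OK_mult [simp]: "x \<in> OK d \<Longrightarrow> y \<in> OK d \<Longrightarrow> x * y \<in> OK d"
proof (elim OK_E)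
  fix m n m' n'
  assume xy: "x = of_int m + of_int n * theta" "y = of_int m' + of_int n' * theta"
  have "x * y = of_int m * of_int m' + (of_int m * of_int n' + of_int n * of_int m') * theta
                + of_int n * of_int n' * (theta * theta)"
    by (simp add: xy algebra_simps)
  then show "x * y \<in> OK d"
    unfolding theta_sq
    by (intro OK_I[where m = "m * m' - n * n' * enorm" and n = "m * n' + n * m' + n * n' * d"])
       (simp add: algebra_simps)
qed

lemma OK_diff [simp]: "x \<in> OK d \<Longrightarrow> y \<in> OK d \<Longrightarrow> x - y \<in> OK d"
  using OK_add[of x "(-1) * y"] OK_mult[of "-1" y] OK_of_int[of "-1"] by simp

lemma OK_lin_indep:
  assumes "of_int m + of_int n * theta = of_int m' + of_int n' * theta"
  shows "m = m'" "n = n'"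
  using lin_indep_Im[of theta n m n' m'] Im_theta assms by (simp_all add: add.commute less_le)

text \<open>The norm of x. Since the conjugate is itself a multiplier in O_K, every nonzero ideal of
  O_K contains a positive rational integer.\<close>

lemma OK_norm:
  assumes "x \<in> OK d" "x \<noteq> 0"
  obtains n where "n > 0" "of_int n = x * cnj x" "cnj x \<in> OK d"
proof -
  obtain u v where x: "x = of_int u + of_int v * theta" using assms(1) by (rule OK_E)
  have ct: "cnj theta = of_int d - theta"
    by (simp add: theta_def complex_eq_iff field_simps)
  have c: "cnj x = of_int (u + v * d) + of_int (- v) * theta"
    by (simp add: x ct algebra_simps)
  then have cx: "cnj x \<in> OK d" by (rule OK_I)
  define n where "n = u * u + u * v * d + v * v * enorm"
  have "x * cnj x = of_int u * of_int u + of_int u * of_int v * of_int d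
     + of_int v * of_int v * (of_int d * theta - theta * theta)"
    unfolding c by (simp add: x algebra_simps)
  then have n: "x * cnj x = of_int n" unfolding theta_sq by (simp add: n_def)
  have "real_of_int n = (cmod x)\<^sup>2"
    using n complex_norm_square[of x] by (metis of_real_eq_iff of_real_of_int_eq)
  then have "n > 0" using assms(2) by (metis of_int_0_less_iff zero_less_norm_iff zero_less_power)
  then show ?thesis using that n cx by simp
qed

section \<open>Field operations in K and denominators\<close>

lemma K_I: "x \<in> \<rat> \<Longrightarrow> y \<in> \<rat> \<Longrightarrow> x + y * sqrtD d \<in> Kfield d"
  by (auto simp: Kfield_def elim!: Rats_cases)

lemma K_E:
  assumes "x \<in> Kfield d"
  obtains u v where "u \<in> \<rat>" "v \<in> \<rat>" "x = u + v * sqrtD d"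
proof -
  obtain a b where "x = of_rat a + of_rat b * sqrtD d" using assms by (auto simp: Kfield_def)
  then show ?thesis by (intro that[of "of_rat a" "of_rat b"]) simp_all
qed

lemma K_rat: "x \<in> \<rat> \<Longrightarrow> x \<in> Kfield d"
  using K_I[of x 0] by simp

lemma K_of_int [simp]: "of_int x \<in> Kfield d"
  by (rule K_rat) simp

lemma K_of_nat [simp]: "of_nat x \<in> Kfield d"
  by (rule K_rat) simp

lemma K_1 [simp]: "1 \<in> Kfield d"
  by (rule K_rat) simp

lemma K_add [simp]: "x \<in> Kfield d \<Longrightarrow> y \<in> Kfield d \<Longrightarrow> x + y \<in> Kfield d"
proof (elim K_E)
  fix m n m' n' :: complex
  assume "x = m + n * sqrtD d" "y = m' + n' * sqrtD d" "m \<in> \<rat>" "n \<in> \<rat>" "m' \<in> \<rat>" "n' \<in> \<rat>"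
  then show "x + y \<in> Kfield d"
    using K_I[of "m + m'" "n + n'"] by (simp add: algebra_simps)
qed

lemma K_mult [simp]: "x \<in> Kfield d \<Longrightarrow> y \<in> Kfield d \<Longrightarrow> x * y \<in> Kfield d"
proof (elim K_E)
  fix m n m' n' :: complex
  assume *: "x = m + n * sqrtD d" "y = m' + n' * sqrtD d" "m \<in> \<rat>" "n \<in> \<rat>" "m' \<in> \<rat>" "n' \<in> \<rat>"
  have "x * y = m * m' + (m * n' + n * m') * sqrtD d + n * n' * (sqrtD d * sqrtD d)"
    by (simp add: * algebra_simps)
  then have "x * y = (m * m' + n * n' * of_int d) + (m * n' + n * m') * sqrtD d"
    by (simp add: sqrtD_sq algebra_simps)
  then show "x * y \<in> Kfield d" using K_I * by simp
qed

lemma K_theta [simp]: "theta \<in> Kfield d"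
proof -
  have "theta = of_int d / 2 + (1 / 2) * sqrtD d" by (simp add: theta_def add_divide_distrib)
  then show ?thesis using K_I[of "of_int d / 2" "1 / 2"] by simp
qed

lemma OK_K: "x \<in> OK d \<Longrightarrow> x \<in> Kfield d"
  by (auto elim!: OK_E)

lemma K_denominator:
  assumes "x \<in> Kfield d"
  obtains k :: int where "k > 0" "of_int k * x \<in> OK d"
proof -
  obtain u v :: rat where x: "x = of_rat u + of_rat v * sqrtD d"
    using assms by (auto simp: Kfield_def)
  obtain a b where u: "u = Fract a b" "b > 0" by (cases u) auto
  obtain r s where v: "v = Fract r s" "s > 0" by (cases v) auto
  have "of_int (b * s) * x = of_int (a * s) + of_int (r * b) * sqrtD d"
    using u v by (simp add: x of_rat_rat field_simps)
  also have "\<dots> = of_int (a * s - r * b * d) + of_int (2 * r * b) * theta"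
    by (simp add: theta_def algebra_simps)
  finally have "of_int (b * s) * x \<in> OK d" by (rule OK_I)
  then show ?thesis using that[of "b * s"] u v by simp
qed

lemma K_inverse [simp]:
  assumes "x \<in> Kfield d" shows "inverse x \<in> Kfield d"
proof (cases "x = 0")
  case False
  obtain k where k: "k > 0" "of_int k * x \<in> OK d" using assms by (rule K_denominator)
  let ?y = "of_int k * x"
  obtain n where n: "n > 0" "of_int n = ?y * cnj ?y" "cnj ?y \<in> OK d"
    using OK_norm[of ?y] k False by auto
  have "inverse x = of_int k * cnj ?y * inverse (of_int n)"
    using n(1) k(1) False unfolding n(2) by (simp add: field_simps)
  then show ?thesis using n(3) OK_K K_rat[of "inverse (of_int n)"] by auto
qed (use assms in simp)

lemma K_divide [simp]: "x \<in> Kfield d \<Longrightarrow> y \<in> Kfield d \<Longrightarrow> x / y \<in> Kfield d"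
  by (simp add: divide_inverse)

section \<open>Modules over the ring of integers\<close>

text \<open>O_K-submodules of the complex plane. Negatives are covered by the scalar -1; finite
  generation is kept apart, in \<open>frac_ideal\<close>.\<close>

definition omod :: "complex set \<Rightarrow> bool" where
  "omod M \<longleftrightarrow> 0 \<in> M \<and> (\<forall>x\<in>M. \<forall>y\<in>M. x + y \<in> M) \<and> (\<forall>c\<in>OK d. \<forall>x\<in>M. c * x \<in> M)"

lemma omodD:
  assumes "omod M"
  shows "0 \<in> M" "x \<in> M \<Longrightarrow> y \<in> M \<Longrightarrow> x + y \<in> M" "c \<in> OK d \<Longrightarrow> x \<in> M \<Longrightarrow> c * x \<in> M"
  using assms by (auto simp: omod_def)

lemma omod_int: "omod M \<Longrightarrow> x \<in> M \<Longrightarrow> of_int k * x \<in> M"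
  by (simp add: omodD)

lemma omod_minus: "omod M \<Longrightarrow> x \<in> M \<Longrightarrow> - x \<in> M"
  using omod_int[of M x "-1"] by simp

lemma omod_sum: "omod M \<Longrightarrow> (\<And>s. s \<in> F \<Longrightarrow> g s \<in> M) \<Longrightarrow> sum g F \<in> M"
  by (induction F rule: infinite_finite_induct) (auto simp: omodD)

lemma omod_OK: "omod (OK d)"
  by (simp add: omod_def)

lemma omod_image: "omod M \<Longrightarrow> omod ((*) c ` M)"
  unfolding omod_def
proof (intro conjI ballI)
  assume M: "0 \<in> M \<and> (\<forall>x\<in>M. \<forall>y\<in>M. x + y \<in> M) \<and> (\<forall>c\<in>OK d. \<forall>x\<in>M. c * x \<in> M)"
  then show "0 \<in> (*) c ` M" by force
  fix x assume "x \<in> (*) c ` M"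
  then obtain u where u: "x = c * u" "u \<in> M" by auto
  {
    fix y assume "y \<in> (*) c ` M"
    then obtain v where "y = c * v" "v \<in> M" by auto
    then have "x + y = c * (u + v)" "u + v \<in> M" using u M by (auto simp: distrib_left)
    then show "x + y \<in> (*) c ` M" by blast
  }
  fix b assume "b \<in> OK d"
  then have "b * x = c * (b * u)" "b * u \<in> M" using u M by auto
  then show "b * x \<in> (*) c ` M" by blast
qed

text \<open>The colon module (M : S). To bound a product of modules by M, one factor is varied: its
  admissible values form this module, so generators suffice.\<close>

lemma omod_quotient: "omod M \<Longrightarrow> omod {x. \<forall>y\<in>S. x * y \<in> M}"
  by (auto simp: omod_def distrib_right mult.assoc)

lemma omod_span: "omod (OK_span d S)"
  unfolding omod_def
proof (intro conjI ballI)
  show "0 \<in> OK_span d S"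
    unfolding OK_span_def by (intro CollectI exI[of _ "{}"] exI[of _ "\<lambda>_. 0"]) simp
next
  fix x y assume "x \<in> OK_span d S" "y \<in> OK_span d S"
  then obtain F f G g where
    F: "finite F" "F \<subseteq> S" "\<forall>s\<in>F. f s \<in> OK d" "x = (\<Sum>s\<in>F. f s * s)" and
    G: "finite G" "G \<subseteq> S" "\<forall>s\<in>G. g s \<in> OK d" "y = (\<Sum>s\<in>G. g s * s)"
    unfolding OK_span_def by blast
  \<comment> \<open>Both coefficient families are extended by zero to the union, so that they add
    where the supports overlap.\<close>
  define h where "h s = (if s \<in> F then f s else 0) + (if s \<in> G then g s else 0)" for s
  have "x = (\<Sum>s\<in>F \<union> G. (if s \<in> F then f s else 0) * s)"
    unfolding F(4) using F(1) G(1) by (intro sum.mono_neutral_cong_left) auto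
  moreover have "y = (\<Sum>s\<in>F \<union> G. (if s \<in> G then g s else 0) * s)"
    unfolding G(4) using F(1) G(1) by (intro sum.mono_neutral_cong_left) auto
  ultimately have "x + y = (\<Sum>s\<in>F \<union> G. h s * s)"
    by (simp only: h_def distrib_right sum.distrib)
  moreover have "\<forall>s\<in>F \<union> G. h s \<in> OK d" using F(3) G(3) by (auto simp: h_def)
  ultimately show "x + y \<in> OK_span d S"
    unfolding OK_span_def using F(1,2) G(1,2)
    by (intro CollectI exI[of _ "F \<union> G"] exI[of _ h]) auto
next
  fix c x assume c: "c \<in> OK d" and "x \<in> OK_span d S"
  then obtain F f where
    F: "finite F" "F \<subseteq> S" "\<forall>s\<in>F. f s \<in> OK d" "x = (\<Sum>s\<in>F. f s * s)"
    unfolding OK_span_def by blast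
  show "c * x \<in> OK_span d S"
    unfolding OK_span_def using F c
    by (intro CollectI exI[of _ F] exI[of _ "\<lambda>s. c * f s"])
       (auto simp: sum_distrib_left mult.assoc)
qed

lemma span_superset: "S \<subseteq> OK_span d S"
proof
  fix s assume "s \<in> S"
  then show "s \<in> OK_span d S"
    unfolding OK_span_def by (intro CollectI exI[of _ "{s}"] exI[of _ "\<lambda>_. 1"]) simp
qed

lemma span_least:
  assumes "omod M" "S \<subseteq> M" shows "OK_span d S \<subseteq> M"
proof
  fix x assume "x \<in> OK_span d S"
  then obtain F f where "F \<subseteq> S" "\<forall>s\<in>F. f s \<in> OK d" "x = (\<Sum>s\<in>F. f s * s)"
    unfolding OK_span_def by blast
  then show "x \<in> M" using assms by (auto intro!: omod_sum omodD(3))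
qed

lemma ideal_mult_omod: "omod (ideal_mult d M M')"
  unfolding ideal_mult_def by (rule omod_span)

lemma ideal_multI: "x \<in> M \<Longrightarrow> y \<in> M' \<Longrightarrow> x * y \<in> ideal_mult d M M'"
  unfolding ideal_mult_def by (rule subsetD[OF span_superset]) blast

lemma ideal_mult_least:
  assumes "omod L" "\<And>x y. x \<in> M \<Longrightarrow> y \<in> M' \<Longrightarrow> x * y \<in> L"
  shows "ideal_mult d M M' \<subseteq> L"
  unfolding ideal_mult_def using assms by (intro span_least) auto

lemma ideal_mult_comm: "ideal_mult d M M' = ideal_mult d M' M"
proof -
  have "ideal_mult d M M' \<subseteq> ideal_mult d M' M" for M M'
    by (rule ideal_mult_least[OF ideal_mult_omod]) (subst mult.commute, rule ideal_multI)
  then show ?thesis by blast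
qed

text \<open>For fixed \<open>y\<close> in M', the x with x y on the right-hand side form a colon
  module, which leaves only products of elements of L and M to check.\<close>

lemma ideal_mult_assoc_subset:
  "ideal_mult d (ideal_mult d L M) M' \<subseteq> ideal_mult d L (ideal_mult d M M')"
proof (rule ideal_mult_least[OF ideal_mult_omod])
  fix x y assume x: "x \<in> ideal_mult d L M" and y: "y \<in> M'"
  have "ideal_mult d L M \<subseteq> {x. \<forall>z\<in>{y}. x * z \<in> ideal_mult d L (ideal_mult d M M')}"
    by (rule ideal_mult_least[OF omod_quotient[OF ideal_mult_omod]])
       (auto simp: mult.assoc intro!: ideal_multI y)
  then show "x * y \<in> ideal_mult d L (ideal_mult d M M')" using x by auto
qed

lemma ideal_mult_assoc:
  "ideal_mult d (ideal_mult d L M) M' = ideal_mult d L (ideal_mult d M M')"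
  by (rule antisym) (use ideal_mult_assoc_subset in \<open>metis ideal_mult_comm\<close>)+

lemma principal_eq: "principal d \<nu> = (*) \<nu> ` OK d"
  by (auto simp: principal_def)

lemma principal_self: "\<nu> \<in> principal d \<nu>"
  using image_eqI[of \<nu> "(*) \<nu>" 1 "OK d"] by (simp add: principal_eq)

lemma ideal_mult_scale: "ideal_mult d ((*) c ` M) M' = (*) c ` ideal_mult d M M'"
proof
  show "ideal_mult d ((*) c ` M) M' \<subseteq> (*) c ` ideal_mult d M M'"
    by (rule ideal_mult_least[OF omod_image[OF ideal_mult_omod]])
       (auto simp: mult.assoc intro!: imageI ideal_multI)
  have "ideal_mult d M M' \<subseteq> {x. \<forall>y\<in>{c}. x * y \<in> ideal_mult d ((*) c ` M) M'}"
  proof (rule ideal_mult_least[OF omod_quotient[OF ideal_mult_omod]])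
    fix x y assume "x \<in> M" "y \<in> M'"
    then have "c * x * y \<in> ideal_mult d ((*) c ` M) M'" by (intro ideal_multI imageI)
    then show "x * y \<in> {x. \<forall>y\<in>{c}. x * y \<in> ideal_mult d ((*) c ` M) M'}"
      by (simp add: ac_simps)
  qed
  then show "(*) c ` ideal_mult d M M' \<subseteq> ideal_mult d ((*) c ` M) M'"
    by (auto simp: mult.commute)
qed

lemma ideal_mult_OK:
  assumes "omod M" shows "ideal_mult d (OK d) M = M"
proof
  show "ideal_mult d (OK d) M \<subseteq> M"
    using assms by (intro ideal_mult_least) (auto simp: omodD)
  show "M \<subseteq> ideal_mult d (OK d) M"
    using ideal_multI[of 1 "OK d" _ M] by auto
qed

lemma ideal_mult_principal: "omod M \<Longrightarrow> ideal_mult d (principal d \<nu>) M = (*) \<nu> ` M"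
  by (simp add: principal_eq ideal_mult_scale ideal_mult_OK)

lemma span_scale: "OK_span d ((*) c ` S) = (*) c ` OK_span d S"
proof
  show "OK_span d ((*) c ` S) \<subseteq> (*) c ` OK_span d S"
    by (intro span_least omod_image omod_span image_mono span_superset)
  have "OK_span d S \<subseteq> {x. \<forall>y\<in>{c}. x * y \<in> OK_span d ((*) c ` S)}"
    using span_superset[of "(*) c ` S"]
    by (intro span_least omod_quotient omod_span) (auto simp: mult.commute[of _ c])
  then show "(*) c ` OK_span d S \<subseteq> OK_span d ((*) c ` S)"
    by (auto simp: mult.commute)
qed

text \<open>Two colon arguments, one for each factor. This is what keeps products of fractional
  ideals finitely generated.\<close>

lemma span_mult:
  "ideal_mult d (OK_span d S) (OK_span d T) = OK_span d ((\<lambda>(s, t). s * t) ` (S \<times> T))"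
    (is "_ = OK_span d ?P")
proof
  have "OK_span d S \<subseteq> {x. \<forall>y\<in>T. x * y \<in> OK_span d ?P}"
    using span_superset[of ?P] by (intro span_least omod_quotient omod_span) auto
  then have "x * y \<in> OK_span d ?P" if "x \<in> OK_span d S" "y \<in> T" for x y
    using that by blast
  then have "y * x \<in> OK_span d ?P" if "y \<in> T" "x \<in> OK_span d S" for x y
    using that by (metis mult.commute)
  then have "OK_span d T \<subseteq> {y. \<forall>x\<in>OK_span d S. y * x \<in> OK_span d ?P}"
    by (intro span_least omod_quotient omod_span) blast
  then have "y * x \<in> OK_span d ?P" if "x \<in> OK_span d S" "y \<in> OK_span d T" for x y
    using that by blast
  then have "x * y \<in> OK_span d ?P" if "x \<in> OK_span d S" "y \<in> OK_span d T" for x y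
    using that by (metis mult.commute)
  then show "ideal_mult d (OK_span d S) (OK_span d T) \<subseteq> OK_span d ?P"
    by (intro ideal_mult_least omod_span) auto
  show "OK_span d ?P \<subseteq> ideal_mult d (OK_span d S) (OK_span d T)"
    using span_superset[of S] span_superset[of T]
    by (intro span_least ideal_mult_omod) (auto intro!: ideal_multI)
qed

section \<open>Fractional ideals as lattices of rank two\<close>

lemma frac_ideal_omod: "frac_ideal d M \<Longrightarrow> omod M"
  by (auto simp: frac_ideal_def intro: omod_span)

lemma frac_ideal_nonzero:
  assumes "frac_ideal d M" obtains x where "x \<in> M" "x \<noteq> 0"
  using assms omodD(1)[OF frac_ideal_omod[OF assms]] by (auto simp: frac_ideal_def)

lemma frac_ideal_scale:
  assumes "frac_ideal d M" "c \<in> Kfield d" "c \<noteq> 0"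
  shows "frac_ideal d ((*) c ` M)"
proof -
  obtain S where S: "finite S" "S \<subseteq> Kfield d" "M = OK_span d S"
    using assms(1) by (auto simp: frac_ideal_def)
  obtain x where "x \<in> M" "x \<noteq> 0" using assms(1) by (rule frac_ideal_nonzero)
  then have "c * x \<in> (*) c ` M" "c * x \<noteq> 0" using assms(3) by auto
  then have "(*) c ` M \<noteq> {0}" by blast
  moreover have "(*) c ` S \<subseteq> Kfield d" using S(2) assms(2) by auto
  ultimately show ?thesis
    unfolding frac_ideal_def S(3) span_scale[symmetric] using S(1)
    by (intro conjI exI[of _ "(*) c ` S"]) simp_all
qed

lemma frac_ideal_mult:
  assumes "frac_ideal d M" "frac_ideal d M'"
  shows "frac_ideal d (ideal_mult d M M')"
proof -
  obtain S where S: "finite S" "S \<subseteq> Kfield d" "M = OK_span d S"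
    using assms(1) by (auto simp: frac_ideal_def)
  obtain T where T: "finite T" "T \<subseteq> Kfield d" "M' = OK_span d T"
    using assms(2) by (auto simp: frac_ideal_def)
  obtain x where x: "x \<in> M" "x \<noteq> 0" using assms(1) by (rule frac_ideal_nonzero)
  obtain y where y: "y \<in> M'" "y \<noteq> 0" using assms(2) by (rule frac_ideal_nonzero)
  have "x * y \<in> ideal_mult d M M'" "x * y \<noteq> 0" using x y by (auto intro: ideal_multI)
  then have "ideal_mult d M M' \<noteq> {0}" by blast
  moreover have "(\<lambda>(s, t). s * t) ` (S \<times> T) \<subseteq> Kfield d" using S(2) T(2) by (auto simp: subset_iff)
  ultimately show ?thesis
    unfolding frac_ideal_def S(3) T(3) span_mult using S(1) T(1)
    by (intro conjI exI[of _ "(\<lambda>(s, t). s * t) ` (S \<times> T)"]) simp_all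
qed

text \<open>As O_K = Z + Z \<theta>, stability under the single multiplier \<open>theta\<close> is
  enough, and it need only be tested on the two generators.\<close>

lemma omod_zlat:
  assumes "theta * x \<in> zlat x y" "theta * y \<in> zlat x y"
  shows "omod (zlat x y)"
  unfolding omod_def
proof (intro conjI ballI)
  show "0 \<in> zlat x y" by (rule zlatI[where m = 0 and n = 0]) simp
  show add: "u + v \<in> zlat x y" if "u \<in> zlat x y" "v \<in> zlat x y" for u v
    using that by (elim zlatE, hypsubst, rename_tac m n m' n',
        rule_tac m = "m + m'" and n = "n + n'" in zlatI) (simp add: algebra_simps)
  have int: "of_int k * u \<in> zlat x y" if "u \<in> zlat x y" for u k
    using that by (elim zlatE, hypsubst, rename_tac m n,
        rule_tac m = "k * m" and n = "k * n" in zlatI) (simp add: algebra_simps)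
  fix c u assume "c \<in> OK d" and u: "u \<in> zlat x y"
  then obtain m n where c: "c = of_int m + of_int n * theta" by (auto elim: OK_E)
  obtain p q where uu: "u = of_int p * x + of_int q * y" using u by (rule zlatE)
  have "c * u = of_int m * u + of_int n * (of_int p * (theta * x) + of_int q * (theta * y))"
    by (simp add: c uu algebra_simps)
  then show "c * u \<in> zlat x y" using u assms by (auto intro!: add int)
qed

lemma frac_ideal_zlat:
  assumes "omod (zlat x y)" "x \<in> Kfield d" "y \<in> Kfield d" "y \<noteq> 0"
  shows "frac_ideal d (zlat x y)"
proof -
  have "zlat x y \<subseteq> OK_span d {x, y}"
    using span_superset[of "{x, y}"] by (auto elim!: zlatE intro!: omodD[OF omod_span])
  moreover have "OK_span d {x, y} \<subseteq> zlat x y"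
    using assms(1) zlat_left zlat_right by (intro span_least) auto
  moreover have "zlat x y \<noteq> {0}" using zlat_right[of y x] assms(4) by blast
  ultimately show ?thesis
    unfolding frac_ideal_def using assms(2,3)
    by (intro conjI exI[of _ "{x, y}"]) auto
qed

lemma OK_eq_zlat: "OK d = zlat theta 1"
proof -
  have "x \<in> zlat theta 1" if "x \<in> OK d" for x
    using that by (elim OK_E, hypsubst, rename_tac m n, rule_tac m = n and n = m in zlatI) simp
  moreover have "x \<in> OK d" if "x \<in> zlat theta 1" for x
    using that by (elim zlatE, hypsubst, rename_tac m n, rule_tac m = n and n = m in OK_I) simp
  ultimately show ?thesis by blast
qed

lemma frac_ideal_OK: "frac_ideal d (OK d)"
  using frac_ideal_zlat[of theta 1] omod_OK by (simp add: OK_eq_zlat[symmetric])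

lemma frac_ideal_principal: "\<nu> \<in> Kfield d \<Longrightarrow> \<nu> \<noteq> 0 \<Longrightarrow> frac_ideal d (principal d \<nu>)"
  unfolding principal_eq by (rule frac_ideal_scale[OF frac_ideal_OK])

lemma frac_ideal_denominator:
  assumes "frac_ideal d M"
  obtains k :: int where "k > 0" "\<And>x. x \<in> M \<Longrightarrow> of_int k * x \<in> OK d"
proof -
  obtain S where S: "finite S" "S \<subseteq> Kfield d" "M = OK_span d S"
    using assms by (auto simp: frac_ideal_def)
  have "\<exists>k::int. k > 0 \<and> (\<forall>s\<in>S. of_int k * s \<in> OK d)"
    using S(1,2)
  proof induction
    case (insert s S)
    then obtain k :: int where k: "k > 0" "\<forall>s\<in>S. of_int k * s \<in> OK d" by auto
    obtain l where l: "l > 0" "of_int l * s \<in> OK d"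
      using K_denominator[of s] insert.prems by auto
    have "of_int (l * k) * t \<in> OK d" if "t \<in> insert s S" for t
    proof (cases "t = s")
      case True
      then show ?thesis using l(2) OK_mult[OF OK_of_int[of k] l(2)] by (simp add: ac_simps)
    next
      case False
      then have "of_int k * t \<in> OK d" using that k by auto
      then show ?thesis by (metis OK_mult OK_of_int mult.assoc of_int_mult)
    qed
    then show ?case using k(1) l(1) by (intro exI[of _ "l * k"]) simp
  qed (auto intro: exI[of _ 1])
  then obtain k :: int where k: "k > 0" "\<forall>s\<in>S. of_int k * s \<in> OK d" by blast
  then have "OK_span d S \<subseteq> {x. \<forall>y\<in>{of_int k}. x * y \<in> OK d}"
    by (intro span_least omod_quotient omod_OK) (auto simp: mult.commute)
  then show ?thesis using that[of k] k(1) S(3) by (auto simp: mult.commute)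
qed

text \<open>An ideal \<open>I\<close> of \<open>O\<^sub>K\<close> has the Hermite basis \<open>s + r\<theta>\<close>, \<open>n\<close>, where \<open>n\<close>
  generates \<open>I \<inter> Z\<close> and \<open>r\<close> generates the group of \<open>\<theta>\<close>-coordinates.\<close>

lemma frac_ideal_basis:
  assumes "frac_ideal d M"
  obtains x y where "M = zlat x y" "y \<noteq> 0" "x \<in> Kfield d" "y \<in> Kfield d" "Im (x / y) > 0"
proof -
  note M = frac_ideal_omod[OF assms]
  obtain k where k: "k > 0" "\<And>x. x \<in> M \<Longrightarrow> of_int k * x \<in> OK d"
    using frac_ideal_denominator[OF assms] by blast
  obtain x0 where x0: "x0 \<in> M" "x0 \<noteq> 0" using assms by (rule frac_ideal_nonzero)
  define I where "I = (*) (of_int k) ` M"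
  have I: "omod I" "I \<subseteq> OK d" using omod_image[OF M] k(2) by (auto simp: I_def)
  have "of_int k * x0 \<in> I" "of_int k * x0 \<noteq> 0" using x0 k(1) by (auto simp: I_def)
  \<comment> \<open>The norm of a nonzero element of \<open>I\<close> is a multiple of that element,
    hence in \<open>I\<close>.\<close>
  then obtain n0 where "n0 > 0" "of_int n0 \<in> I"
    using I OK_norm[of "of_int k * x0"] omodD(3)[OF I(1)] by (metis mult.commute subset_iff)
  then have ex_n: "\<exists>n::nat. n > 0 \<and> of_nat n \<in> I"
    by (intro exI[of _ "nat n0"]) auto
  define n where "n = (LEAST n::nat. n > 0 \<and> of_nat n \<in> I)"
  have n: "n > 0" "of_int (int n) \<in> I" using LeastI_ex[OF ex_n] by (auto simp: n_def)
  have n_dvd: "int n dvd a" if "of_int a \<in> I" for a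
  proof -
    have "of_int (a mod int n) = of_int a + of_int (- (a div int n)) * (of_int (int n) :: complex)"
      by (simp add: minus_div_mult_eq_mod[symmetric])
    then have "of_int (a mod int n) \<in> I"
      by (simp only:) (intro omodD(2)[OF I(1)] omod_int[OF I(1)] that n(2))
    then have "\<not> (0 < nat (a mod int n) \<and> nat (a mod int n) < n)"
      using not_less_Least[of "nat (a mod int n)" "\<lambda>n. n > 0 \<and> of_nat n \<in> I"] n(1)
      by (auto simp: n_def[symmetric])
    moreover have "a mod int n \<ge> 0" "nat (a mod int n) < n"
      using n(1) by (simp_all add: nat_less_iff)
    ultimately have "a mod int n = 0" by auto
    then show ?thesis by (simp add: dvd_eq_mod_eq_0)
  qed
  let ?P = "\<lambda>r::nat. r > 0 \<and> (\<exists>s. of_int s + of_nat r * theta \<in> I)"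
  \<comment> \<open>Shows that positive \<theta>-coordinates occur, so that a least one
    exists.\<close>
  have "of_int (int n) * theta \<in> I"
    using omodD(3)[OF I(1) OK_theta n(2)] by (simp add: mult.commute)
  then have ex_r: "\<exists>r. ?P r" using n(1) by (intro exI[of _ n] conjI exI[of _ 0]) auto
  define r where "r = Least ?P"
  have "?P r" unfolding r_def by (rule LeastI_ex[OF ex_r])
  then obtain s where s: "r > 0" "of_int s + of_int (int r) * theta \<in> I" by auto
  let ?x = "of_int s + of_int (int r) * theta"
  have r_dvd: "int r dvd b" if "of_int a + of_int b * theta \<in> I" for a b
  proof -
    have "of_int (a - (b div int r) * s) + of_int (b mod int r) * theta =
      (of_int a + of_int b * theta) + of_int (- (b div int r)) * ?x"
      by (simp add: minus_div_mult_eq_mod[symmetric] algebra_simps)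
    then have "of_int (a - (b div int r) * s) + of_int (b mod int r) * theta \<in> I"
      by (simp only:) (intro omodD(2)[OF I(1)] omod_int[OF I(1)] that s(2))
    then have "\<exists>s. of_int s + of_int (b mod int r) * theta \<in> I" by blast
    then have "\<not> (0 < nat (b mod int r) \<and> nat (b mod int r) < r)"
      using not_less_Least[of "nat (b mod int r)" ?P] s(1) by (auto simp: r_def[symmetric])
    moreover have "b mod int r \<ge> 0" "nat (b mod int r) < r"
      using s(1) by (simp_all add: nat_less_iff)
    ultimately have "b mod int r = 0" by auto
    then show ?thesis by (simp add: dvd_eq_mod_eq_0)
  qed
  have "I \<subseteq> zlat ?x (of_int (int n))"
  proof
    fix z assume z: "z \<in> I"
    then obtain a b where ab: "z = of_int a + of_int b * theta" using I(2) OK_E by blast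
    then obtain q where q: "b = int r * q" using r_dvd z by (metis dvd_def)
    have "of_int (a - q * s) = z + of_int (- q) * ?x" by (simp add: ab q algebra_simps)
    then have "of_int (a - q * s) \<in> I"
      by (simp only:) (intro omodD(2)[OF I(1)] omod_int[OF I(1)] z s(2))
    then obtain p where p: "a - q * s = int n * p" using n_dvd by (metis dvd_def)
    show "z \<in> zlat ?x (of_int (int n))"
    proof (rule zlatI)
      have "a = int n * p + q * s" using p by simp
      then show "z = of_int q * ?x + of_int p * of_int (int n)"
        by (simp add: ab q algebra_simps)
    qed
  qed
  moreover have "zlat ?x (of_int (int n)) \<subseteq> I"
    using s(2) n(2) I(1) by (auto elim!: zlatE intro!: omodD(2) omod_int simp del: of_int_of_nat_eq)
  ultimately have I_eq: "I = zlat ?x (of_int (int n))" by blast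
  have "M = (*) (inverse (of_int k)) ` I"
    using k(1) by (simp add: I_def image_image mult.assoc[symmetric])
  then have M_eq: "M = zlat (inverse (of_int k) * ?x) (inverse (of_int k) * of_int (int n))"
    unfolding I_eq zlat_scale .
  have Kk: "inverse (of_int k) \<in> Kfield d" by simp
  have "(inverse (of_int k) * ?x) / (inverse (of_int k) * of_int (int n)) = ?x / of_int (int n)"
    using k(1) by simp
  also have "Im \<dots> > 0" using n(1) s(1) by (simp add: Im_divide_of_nat)
  finally have Im: "Im ((inverse (of_int k) * ?x) / (inverse (of_int k) * of_int (int n))) > 0" .
  show ?thesis
    by (rule that[OF M_eq _ _ _ Im]) (use k(1) n(1) Kk in \<open>auto intro!: K_mult[OF Kk]\<close>)
qed

section \<open>Lattices attached to forms\<close>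

text \<open>Primitivity follows from \<open>d\<close> being fundamental, negativity of the
  discriminant from \<open>d_neg\<close>.\<close>

lemma Qd_iff: "(a, b, c) \<in> Qd d \<longleftrightarrow> a > 0 \<and> b\<^sup>2 - 4 * a * c = d"
  using primitive_of_fundamental[OF disc, of b a c] d_neg by (auto simp: Qd_def)

lemma QN_iff: "(a, b, c) \<in> QN d N \<longleftrightarrow> (a, b, c) \<in> Qd d \<and> coprime (int N) a"
  by (auto simp: QN_def coprime_iff_gcd_eq_1)

lemma QN_Qd: "Q \<in> QN d N \<Longrightarrow> Q \<in> Qd d"
  by (auto simp: QN_def)

lemma omega_mult: "a > 0 \<Longrightarrow> 2 * of_int a * omega d (a, b, c) = - of_int b + sqrtD d"
  by (simp add: omega_def)

lemma Im_omega: "Q \<in> Qd d \<Longrightarrow> Im (omega d Q) > 0"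
proof (cases Q)
  case (fields a b c)
  assume "Q \<in> Qd d"
  then have a: "a > 0" by (simp add: fields Qd_iff)
  have "2 * of_int a * Im (omega d Q) = Im (sqrtD d)"
    using arg_cong[OF omega_mult[OF a, of b c], of Im] by (simp add: fields)
  also have "\<dots> > 0" by simp
  finally show ?thesis using a by (simp add: zero_less_mult_iff)
qed

lemma omega_K: "Q \<in> Qd d \<Longrightarrow> omega d Q \<in> Kfield d"
proof (cases Q)
  case (fields a b c)
  have "omega d Q = of_int (- b) / of_int (2 * a) + (1 / of_int (2 * a)) * sqrtD d"
    by (simp add: fields omega_def add_divide_distrib diff_divide_distrib)
  then show ?thesis by (metis K_I Rats_divide Rats_1 Rats_of_int)
qed

lemma omega_root:
  assumes "(a, b, c) \<in> Qd d"
  shows "of_int a * (omega d (a, b, c) * omega d (a, b, c)) =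
         - of_int b * omega d (a, b, c) - of_int c"
proof -
  let ?w = "omega d (a, b, c)"
  have a: "a > 0" and d: "b\<^sup>2 - 4 * a * c = d" using assms by (auto simp: Qd_iff)
  have "(2 * of_int a * ?w + of_int b) * (2 * of_int a * ?w + of_int b) = of_int d"
    using omega_mult[OF a] by (simp add: sqrtD_sq)
  also have "of_int d = of_int b * of_int b - 4 * of_int a * (of_int c :: complex)"
    unfolding d[symmetric] by (simp add: power2_eq_square)
  finally have "4 * of_int a * (of_int a * (?w * ?w)) = 4 * of_int a * (- of_int b * ?w - of_int c)"
    by algebra
  then show ?thesis using a by (metis mult_cancel_left mult_eq_0_iff of_int_eq_0_iff
      less_irrefl zero_neq_numeral)
qed

text \<open>The discriminant equation makes b and d of equal parity, so \<open>theta\<close> and a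
  \<omega> differ by the integer (b + d)/2. This links coordinates in O_K with coordinates in
  [\<omega>, 1].\<close>

lemma theta_omega:
  assumes "(a, b, c) \<in> Qd d"
  obtains h where "2 * h = b + d" "theta = of_int a * omega d (a, b, c) + of_int h"
proof -
  have a: "a > 0" and d: "b\<^sup>2 - 4 * a * c = d" using assms by (auto simp: Qd_iff)
  have "even (b * b - d)" unfolding d[symmetric] by (simp add: power2_eq_square)
  then have "even (b + d)" by auto
  then obtain h where h: "2 * h = b + d" by (metis evenE)
  have "2 * (of_int h :: complex) = of_int b + of_int d"
    using arg_cong[OF h, of "of_int :: int \<Rightarrow> complex"] by simp
  moreover have "2 * theta = of_int d + sqrtD d" by (simp add: theta_def)
  ultimately have "2 * theta = 2 * (of_int a * omega d (a, b, c) + of_int h)"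
    using omega_mult[OF a, of b c] by algebra
  then show ?thesis using that[OF h] by (metis mult_cancel_left zero_neq_numeral)
qed

lemma omod_latt:
  assumes "Q \<in> Qd d"
  shows "omod (latt (omega d Q))"
proof (cases Q)
  case (fields a b c)
  then have Q: "(a, b, c) \<in> Qd d" using assms by simp
  let ?w = "omega d (a, b, c)"
  obtain h where h: "theta = of_int a * ?w + of_int h" using theta_omega[OF Q] by blast
  have "theta * ?w = of_int a * (?w * ?w) + of_int h * ?w"
    by (simp add: h algebra_simps)
  then have "theta * ?w = of_int (h - b) * ?w + of_int (- c) * 1"
    unfolding omega_root[OF Q] by (simp add: algebra_simps)
  moreover have "theta * 1 = of_int a * ?w + of_int h * 1" using h by simp
  ultimately show ?thesis
    unfolding fields latt_eq_zlat by (intro omod_zlat) (rule zlatI, assumption)+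
qed

text \<open>The imaginary part recovers \<open>a\<close>, the equation for 2 a \<omega> then
  \<open>b\<close>, and the discriminant \<open>c\<close>.\<close>

lemma omega_inj:
  assumes "Q \<in> Qd d" "Q' \<in> Qd d" "omega d Q = omega d Q'"
  shows "Q = Q'"
proof -
  obtain a b c a' b' c' where Q: "Q = (a, b, c)" "Q' = (a', b', c')" by (metis prod_cases3)
  have *: "a > 0" "a' > 0" "b\<^sup>2 - 4 * a * c = d" "b'\<^sup>2 - 4 * a' * c' = d"
    using assms(1,2) by (auto simp: Q Qd_iff)
  let ?w = "omega d Q"
  have w: "2 * of_int a * ?w = - of_int b + sqrtD d" "2 * of_int a' * ?w = - of_int b' + sqrtD d"
    using omega_mult *(1,2) assms(3) unfolding Q by metis+
  have "2 * of_int a * Im ?w = 2 * of_int a' * Im ?w"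
    using arg_cong[OF w(1), of Im] arg_cong[OF w(2), of Im] by simp
  then have a: "a = a'" using Im_omega[OF assms(1)] by simp
  with w have "of_int b = (of_int b' :: complex)"
    by (metis add_right_cancel minus_equation_iff)
  then have b: "b = b'" by simp
  have "4 * a * c = 4 * a * c'" using *(3,4) unfolding a b by linarith
  then show ?thesis using *(1) a b Q by simp
qed

text \<open>The multiplier ring of \<open>[w, 1]\<close> being all of \<open>O\<^sub>K\<close> forces \<open>w\<close> to be the root of a
  form whose discriminant is exactly \<open>d\<close>.\<close>

lemma omega_surj:
  assumes "omod (zlat w 1)" "Im w > 0"
  obtains Q where "Q \<in> Qd d" "omega d Q = w"
proof -
  obtain r s where r: "theta = of_int r * w + of_int s"
    using omodD(3)[OF assms(1) OK_theta zlat_right] by (auto elim: zlatE)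
  obtain p q where p: "theta * w = of_int p * w + of_int q"
    using omodD(3)[OF assms(1) OK_theta zlat_left] by (auto elim: zlatE)
  have "Im theta = of_int r * Im w" by (simp add: r)
  then have r0: "r > 0" using Im_theta assms(2)
    by (metis of_int_0_less_iff zero_less_mult_pos2)
  \<comment> \<open>\<open>theta\<close> squared is expanded twice, by its minimal equation and by
    its action on [w, 1]; comparing constant coordinates gives the discriminant relation.\<close>
  have "theta * theta = of_int r * (theta * w) + of_int s * theta"
    using r by (metis distrib_right mult.assoc mult.commute)
  then have "of_int d * theta - of_int enorm = of_int r * (of_int p * w + of_int q) + of_int s * theta"
    by (simp only: theta_sq p)
  then have "of_int (r * p + s * r) * w + of_int (r * q + s * s) =
     of_int (d * r) * w + of_int (d * s - enorm)"
    unfolding r by (simp add: algebra_simps)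
  from lin_indep_Im(2)[OF _ this] have "r * q + s * s = d * s - enorm"
    using assms(2) by auto
  then have "4 * (r * q) + 4 * (s * s) = 4 * (d * s) - 4 * enorm" by simp
  then have "(2 * s - d)\<^sup>2 - 4 * r * (- q) = d"
    unfolding enorm4 by (simp add: power2_eq_square algebra_simps)
  \<comment> \<open>These are the coefficients of r w^2 + (s - p) w - q = 0, where p = d - s because
    \<open>theta\<close> has trace \<open>d\<close>.\<close>
  then have Q: "(r, 2 * s - d, - q) \<in> Qd d" using r0 by (simp add: Qd_iff)
  have "2 * of_int r * w = 2 * theta - of_int (2 * s)" by (simp add: r)
  also have "\<dots> = - of_int (2 * s - d) + sqrtD d" by (simp add: theta_def)
  also have "\<dots> = 2 * of_int r * omega d (r, 2 * s - d, - q)"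
    using omega_mult[OF r0] by simp
  finally have "omega d (r, 2 * s - d, - q) = w" using r0 by simp
  with Q that show ?thesis by blast
qed

lemma frac_ideal_latt: "Q \<in> Qd d \<Longrightarrow> frac_ideal d (latt (omega d Q))"
  unfolding latt_eq_zlat
  by (rule frac_ideal_zlat) (auto simp: omod_latt[unfolded latt_eq_zlat] omega_K)

text \<open>The second vector of an oriented basis is the ratio of the homothety onto [\<omega>, 1],
  so choosing that vector controls the ratio.\<close>

lemma frac_ideal_form:
  assumes "frac_ideal d M" "M = zlat x y" "y \<noteq> 0" "Im (x / y) > 0"
  obtains Q where "Q \<in> Qd d" "omega d Q = x / y" "M = (*) y ` latt (omega d Q)"
proof -
  have M: "M = (*) y ` zlat (x / y) 1" using assms(2,3) by (simp add: zlat_scale)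
  then have "zlat (x / y) 1 = (*) (1 / y) ` M"
    using assms(3) by (simp add: image_image)
  then have "omod (zlat (x / y) 1)" using omod_image[OF frac_ideal_omod[OF assms(1)], of "1 / y"] by simp
  then obtain Q where "Q \<in> Qd d" "omega d Q = x / y" using assms(4) omega_surj by blast
  then show ?thesis using that M by (simp add: latt_eq_zlat)
qed

text \<open>The root of (a, -b, c) is minus the complex conjugate of \<omega>, so this is the
  lattice times its conjugate. The generators \<omega>, v, 1 and \<omega> v = -c/a of the product
  all lie in (1/a) O_K; conversely 1/a is reached by primitivity.\<close>

lemma latt_conj_mult:
  assumes "(a, b, c) \<in> Qd d"
  shows "ideal_mult d (latt (omega d (a, b, c))) (latt (omega d (a, - b, c))) = principal d (1 / of_int a)"
    (is "ideal_mult d (latt ?w) (latt ?v) = _")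
proof
  have a: "a > 0" and d: "b\<^sup>2 - 4 * a * c = d" using assms by (auto simp: Qd_iff)
  have Q': "(a, - b, c) \<in> Qd d" using a d by (simp add: Qd_iff)
  have "2 * of_int a * ?v = 2 * of_int a * (?w + of_int b / of_int a)"
    using omega_mult[OF a, of b c] omega_mult[OF a, of "- b" c] a by (simp add: algebra_simps)
  then have v: "?v = ?w + of_int b / of_int a" using a by simp
  have "of_int a * (?w * ?v) = - of_int c"
    unfolding v using omega_root[OF assms] a by (simp add: algebra_simps eq_neg_iff_add_eq_0)
  then have awv: "of_int a * (?w * ?v) \<in> OK d" and wv: "?w * ?v = - of_int c / of_int a"
    using a OK_of_int[of "- c"] by (simp_all add: field_simps)
  have aw: "of_int a * ?w \<in> OK d" and av: "of_int a * ?v \<in> OK d"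
  proof -
    obtain h where "theta = of_int a * ?w + of_int h" using theta_omega[OF assms] by blast
    then have "of_int a * ?w = theta - of_int h" by simp
    then show "of_int a * ?w \<in> OK d" by simp
    obtain k where "theta = of_int a * ?v + of_int k" using theta_omega[OF Q'] by blast
    then have "of_int a * ?v = theta - of_int k" by simp
    then show "of_int a * ?v \<in> OK d" by simp
  qed
  show "ideal_mult d (latt ?w) (latt ?v) \<subseteq> principal d (1 / of_int a)"
    unfolding principal_eq
  proof (rule ideal_mult_least[OF omod_image[OF omod_OK]])
    fix x y assume "x \<in> latt ?w" "y \<in> latt ?v"
    then obtain m n p q where
      x: "x = of_int m * ?w + of_int n * 1" and y: "y = of_int p * ?v + of_int q * 1"
      unfolding latt_eq_zlat by (auto elim!: zlatE)
    have "of_int a * (x * y) = of_int m * of_int p * (of_int a * (?w * ?v)) +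
      of_int m * of_int q * (of_int a * ?w) + of_int n * of_int p * (of_int a * ?v)
      + of_int n * of_int q * of_int a"
      by (simp add: x y algebra_simps)
    also have "\<dots> \<in> OK d" by (intro aw av awv OK_add OK_mult OK_of_int)
    finally show "x * y \<in> (*) (1 / of_int a) ` OK d"
      using a by (intro image_eqI[of _ _ "of_int a * (x * y)"]) auto
  qed
  let ?M = "ideal_mult d (latt ?w) (latt ?v)"
  have in1: "1 \<in> latt w" "w \<in> latt w" for w
    unfolding latt_eq_zlat by (rule zlat_right) (rule zlat_left)
  have w1: "?w * 1 \<in> ?M" and v1: "1 * ?v \<in> ?M" and wvM: "?w * ?v \<in> ?M" and one: "1 * 1 \<in> ?M"
    by (intro ideal_multI in1)+
  have "1 * ?v + - (?w * 1) \<in> ?M"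
    by (rule omodD(2)[OF ideal_mult_omod v1 omod_minus[OF ideal_mult_omod w1]])
  then have bM: "of_int b / of_int a \<in> ?M" by (simp add: v)
  have cM: "of_int c / of_int a \<in> ?M" using omod_minus[OF ideal_mult_omod wvM] wv by simp
  \<comment> \<open>The product contains 1, b/a = v - w and c/a; Bezout for the primitive triple
    combines them to 1/a.\<close>
  have "gcd a (gcd b c) = 1" using primitive_of_fundamental[OF disc d] .
  then obtain x u where "x * a + u * gcd b c = 1" using bezout_int[of a "gcd b c"] by auto
  moreover obtain v w where "v * b + w * c = gcd b c" using bezout_int[of b c] by auto
  ultimately have "x * a + (u * v) * b + (u * w) * c = 1"
    by (metis add.assoc distrib_left mult.assoc)
  then obtain y z where "x * a + y * b + z * c = 1" by blast
  then have "of_int x * of_int a + of_int y * of_int b + of_int z * of_int c = (1 :: complex)"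
    by (metis of_int_1 of_int_add of_int_mult)
  then have "(1 / of_int a :: complex) = of_int x * (1 * 1) + of_int y * (of_int b / of_int a)
      + of_int z * (of_int c / of_int a)" using a by (simp add: field_simps)
  also have "\<dots> \<in> ?M"
    by (intro omodD(2)[OF ideal_mult_omod] omod_int[OF ideal_mult_omod] one bM cM)
  finally have "1 / of_int a \<in> ?M" .
  then show "principal d (1 / of_int a) \<subseteq> ?M"
    unfolding principal_def using omodD(3)[OF ideal_mult_omod] by (auto simp only: mult.commute)
qed

section \<open>The group of ideals prime to the modulus\<close>

lemma OK_cnj: "x \<in> OK d \<Longrightarrow> cnj x \<in> OK d"
  by (metis OK_norm complex_cnj_zero)

text \<open>In 1 = a + N t the element a is congruent to 1, and its norm is a rational integer in A
  that is still congruent to 1. Conversely such an integer already generates O_K together with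
  N.\<close>

lemma coprime_n_iff:
  assumes "omod A" "A \<subseteq> OK d" "x \<in> A" "x \<noteq> 0" "N > 0"
  shows "coprime_n d N A \<longleftrightarrow> (\<exists>m::int. m > 0 \<and> int N dvd m - 1 \<and> of_int m \<in> A)"
proof
  assume "coprime_n d N A"
  then have "1 \<in> ideal_add A (principal d (of_nat N))" by (simp add: coprime_n_def)
  then obtain a t where a: "a \<in> A" "t \<in> OK d" "1 = a + of_nat N * t"
    by (auto simp: ideal_add_def principal_def)
  show "\<exists>m::int. m > 0 \<and> int N dvd m - 1 \<and> of_int m \<in> A"
  proof (cases "a = 0")
    \<comment> \<open>Now 1 is a multiple of N in O_K, so N = 1 and the congruence is void: the norm
      of the given nonzero \<open>x\<close> serves.\<close>
    case True
    obtain u v where "t = of_int u + of_int v * theta" using a(2) by (rule OK_E)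
    then have "of_int 1 + of_int 0 * theta = of_int (int N * u) + of_int (int N * v) * theta"
      using a(3) True by (simp add: algebra_simps)
    then have "int N * u = 1" using OK_lin_indep(1) by metis
    then have N: "int N = 1" using zmult_eq_1_iff by auto
    obtain m where "m > 0" "of_int m = x * cnj x" "cnj x \<in> OK d"
      using OK_norm[of x] assms(2-4) by blast
    then show ?thesis using omodD(3)[OF assms(1) _ assms(3), of "cnj x"] N
      by (auto simp: mult.commute intro!: exI[of _ m])
  next
    case False
    obtain m where m: "m > 0" "of_int m = a * cnj a" "cnj a \<in> OK d"
      using OK_norm[of a] False a(1) assms(2) by blast
    \<comment> \<open>Chosen so that (1 - N t)(1 - N cnj t) = 1 - N z.\<close>
    define z where "z = t + cnj t - of_nat N * (t * cnj t)"
    have "z \<in> OK d" unfolding z_def using a(2) OK_cnj[OF a(2)] OK_of_int[of "int N"]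
      by (intro OK_add OK_diff OK_mult) simp_all
    then obtain u v where z: "z = of_int u + of_int v * theta" by (rule OK_E)
    have aa: "a = 1 - of_nat N * t" using a(3) by (simp add: algebra_simps)
    then have "cnj a = 1 - of_nat N * cnj t" by simp
    with aa have "of_int m = 1 - of_nat N * z" unfolding m(2) z_def by algebra
    then have "of_int m + of_int 0 * theta = of_int (1 - int N * u) + of_int (- (int N * v)) * theta"
      by (simp add: z algebra_simps)
    then have "m = 1 - int N * u" using OK_lin_indep(1) by metis
    then have "int N dvd m - 1" by simp
    moreover have "of_int m \<in> A"
      using omodD(3)[OF assms(1) m(3) a(1)] m(2) by (simp add: mult.commute)
    ultimately show ?thesis using m(1) by blast
  qed
next
  assume "\<exists>m::int. m > 0 \<and> int N dvd m - 1 \<and> of_int m \<in> A"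
  then obtain m :: int where m: "int N dvd m - 1" "of_int m \<in> A" by blast
  obtain k where k: "m - 1 = int N * k" using m(1) by (rule dvdE)
  have m_eq: "of_int m = 1 + of_nat N * (of_int k :: complex)"
    using arg_cong[OF k, of "of_int :: int \<Rightarrow> complex"] by (simp add: algebra_simps)
  have "ideal_add A (principal d (of_nat N)) \<subseteq> OK d"
    using assms(2) OK_of_int[of "int N"] by (auto simp: ideal_add_def principal_def)
  moreover have "y \<in> ideal_add A (principal d (of_nat N))" if y: "y \<in> OK d" for y
  proof -
    have "y = y * of_int m + of_nat N * (y * of_int (- k))"
      by (simp add: m_eq algebra_simps)
    moreover have "y * of_int m \<in> A" using omodD(3)[OF assms(1) y m(2)] .
    moreover have "y * of_int (- k) \<in> OK d" by (intro OK_mult y OK_of_int)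
    ultimately show ?thesis unfolding ideal_add_def principal_def by blast
  qed
  ultimately show "coprime_n d N A" unfolding coprime_n_def by blast
qed

text \<open>Makes \<open>IK d N\<close> accessible without reference to quotients of integral ideals: the witnesses
  \<open>m\<close>, \<open>k\<close> of two ideals multiply, and those of an inverse ideal are swapped.\<close>

lemma IK_iff:
  assumes "N > 0"
  shows "M \<in> IK d N \<longleftrightarrow> frac_ideal d M \<and>
    (\<exists>m k::int. m > 0 \<and> k > 0 \<and> int N dvd m - 1 \<and> int N dvd k - 1 \<and>
       of_int m \<in> M \<and> (\<forall>x\<in>M. of_int k * x \<in> OK d))"
    (is "_ \<longleftrightarrow> _ \<and> ?R")
proof safe
  assume "M \<in> IK d N"
  then obtain A B where fM: "frac_ideal d M" and A: "integral_ideal d A" "coprime_n d N A"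
    and B: "integral_ideal d B" "coprime_n d N B" and MB: "ideal_mult d M B = A"
    by (auto simp: IK_def)
  note M = frac_ideal_omod[OF fM]
  show "frac_ideal d M" by (rule fM)
  have fA: "frac_ideal d A" "A \<subseteq> OK d" and fB: "frac_ideal d B" "B \<subseteq> OK d"
    using A(1) B(1) by (auto simp: integral_ideal_def)
  obtain xa where "xa \<in> A" "xa \<noteq> 0" using fA(1) by (rule frac_ideal_nonzero)
  with A(2) coprime_n_iff[OF frac_ideal_omod[OF fA(1)] fA(2) _ _ assms]
  obtain m where m: "m > 0" "int N dvd m - 1" "of_int m \<in> A" by blast
  obtain xb where "xb \<in> B" "xb \<noteq> 0" using fB(1) by (rule frac_ideal_nonzero)
  with B(2) coprime_n_iff[OF frac_ideal_omod[OF fB(1)] fB(2) _ _ assms]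
  obtain k where k: "k > 0" "int N dvd k - 1" "of_int k \<in> B" by blast
  \<comment> \<open>The integer of A serves as \<open>m\<close> because B lies in O_K, and the
    integer of B serves as \<open>k\<close> because it carries M into A.\<close>
  have "A \<subseteq> M" unfolding MB[symmetric]
    by (rule ideal_mult_least[OF M], subst mult.commute, rule omodD(3)[OF M]) (use fB(2) in auto)
  moreover have "of_int k * x \<in> OK d" if "x \<in> M" for x
    using ideal_multI[OF that k(3)] MB fA(2) by (auto simp: mult.commute)
  ultimately show ?R using m k by blast
next
  fix m k :: int
  assume fM: "frac_ideal d M" and m: "m > 0" "int N dvd m - 1" "of_int m \<in> M"
    and k: "k > 0" "int N dvd k - 1" "\<forall>x\<in>M. of_int k * x \<in> OK d"
  \<comment> \<open>M is the quotient of kM by k O_K; their integers congruent to 1 are k m and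
    k.\<close>
  define A where "A = (*) (of_int k) ` M"
  define B where "B = principal d (of_int k)"
  have fA: "frac_ideal d A" "A \<subseteq> OK d"
    using k unfolding A_def by (auto intro!: frac_ideal_scale[OF fM])
  have fB: "frac_ideal d B" "B \<subseteq> OK d"
    using k(1) frac_ideal_principal[of "of_int k"] unfolding B_def by (auto simp: principal_def)
  have "of_int (k * m) \<in> A" using m(3) by (auto simp: A_def)
  moreover have "int N dvd k * m - 1" by (rule dvd_mult_minus_one[OF k(2) m(2)])
  moreover have km: "k * m > 0" using k m by simp
  ultimately have "coprime_n d N A"
    using coprime_n_iff[OF frac_ideal_omod[OF fA(1)] fA(2) _ _ assms, of "of_int (k * m)"]
    by (metis of_int_eq_0_iff less_irrefl)
  moreover have "of_int k \<in> B" using principal_self by (simp add: B_def)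
  then have "coprime_n d N B"
    using coprime_n_iff[OF frac_ideal_omod[OF fB(1)] fB(2) _ _ assms, of "of_int k"] k
    by (metis of_int_eq_0_iff less_irrefl)
  moreover have "ideal_mult d M B = A"
    unfolding A_def B_def by (subst ideal_mult_comm) (rule ideal_mult_principal[OF frac_ideal_omod[OF fM]])
  ultimately show "M \<in> IK d N"
    unfolding IK_def integral_ideal_def using fM fA fB by blast
qed

lemma IK_frac: "M \<in> IK d N \<Longrightarrow> frac_ideal d M"
  by (simp add: IK_def)

lemma IK_mult:
  assumes "N > 0" "M \<in> IK d N" "M' \<in> IK d N"
  shows "ideal_mult d M M' \<in> IK d N"
proof -
  obtain m k :: int where m: "m > 0" "k > 0" "int N dvd m - 1" "int N dvd k - 1"
    "of_int m \<in> M" "\<forall>x\<in>M. of_int k * x \<in> OK d"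
    using assms by (auto simp: IK_iff)
  obtain m' k' :: int where m': "m' > 0" "k' > 0" "int N dvd m' - 1" "int N dvd k' - 1"
    "of_int m' \<in> M'" "\<forall>x\<in>M'. of_int k' * x \<in> OK d"
    using assms by (auto simp: IK_iff)
  have "ideal_mult d M M' \<subseteq> {x. \<forall>y\<in>{of_int (k * k')}. x * y \<in> OK d}"
  proof (intro ideal_mult_least omod_quotient omod_OK CollectI ballI)
    fix x y z :: complex assume xy: "x \<in> M" "y \<in> M'" and "z \<in> {of_int (k * k')}"
    then have eq: "x * y * z = (of_int k * x) * (of_int k' * y)" by (simp add: ac_simps)
    show "x * y * z \<in> OK d" unfolding eq by (rule OK_mult) (use m(6) m'(6) xy in auto)
  qed
  then have "\<forall>x\<in>ideal_mult d M M'. of_int (k * k') * x \<in> OK d"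
    by (auto simp: mult.commute)
  moreover have "of_int (m * m') \<in> ideal_mult d M M'"
    using ideal_multI[OF m(5) m'(5)] by simp
  moreover have "m * m' > 0" "k * k' > 0" using m m' by simp_all
  ultimately show ?thesis
    unfolding IK_iff[OF assms(1)]
    using frac_ideal_mult[OF IK_frac[OF assms(2)] IK_frac[OF assms(3)]]
      dvd_mult_minus_one[OF m(3) m'(3)] dvd_mult_minus_one[OF m(4) m'(4)] by blast
qed

lemma IK_OK: "N > 0 \<Longrightarrow> OK d \<in> IK d N"
  unfolding IK_iff using frac_ideal_OK by (auto intro!: exI[of _ 1])

text \<open>Write M = y [\<omega>, 1]. Since [\<omega>, 1] times its conjugate is (1/a) O_K, the
  inverse is a/y times the conjugate lattice.\<close>

lemma frac_ideal_inverse: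
  assumes "frac_ideal d M"
  obtains W where "frac_ideal d W" "ideal_mult d M W = OK d"
proof -
  obtain x y where xy: "M = zlat x y" "y \<noteq> 0" "y \<in> Kfield d" "Im (x / y) > 0"
    using frac_ideal_basis[OF assms] by metis
  obtain Q where Q: "Q \<in> Qd d" "M = (*) y ` latt (omega d Q)"
    using frac_ideal_form[OF assms xy(1,2,4)] by metis
  obtain a b c where abc: "Q = (a, b, c)" by (cases Q)
  have a: "a > 0" and Q': "(a, - b, c) \<in> Qd d" using Q(1) by (auto simp: abc Qd_iff)
  define W where "W = (*) (of_int a / y) ` latt (omega d (a, - b, c))"
  have "ideal_mult d M W = (*) (of_int a / y * y * (1 / of_int a)) ` OK d"
    unfolding W_def Q(2) abc ideal_mult_scale
    by (subst ideal_mult_comm, subst ideal_mult_scale, subst ideal_mult_comm,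
        subst latt_conj_mult)
       (use Q(1) abc in \<open>auto simp: principal_eq image_image ac_simps\<close>)
  also have "\<dots> = OK d" using a xy(2) by simp
  finally have "ideal_mult d M W = OK d" .
  moreover have "frac_ideal d W" unfolding W_def
    using a xy by (intro frac_ideal_scale frac_ideal_latt Q') auto
  ultimately show ?thesis using that by blast
qed

lemma IK_inverse:
  assumes "N > 0" "M \<in> IK d N"
  obtains W where "W \<in> IK d N" "ideal_mult d M W = OK d"
proof -
  obtain W where W: "frac_ideal d W" "ideal_mult d M W = OK d"
    using frac_ideal_inverse[OF IK_frac[OF assms(2)]] .
  obtain m k :: int where m: "m > 0" "k > 0" "int N dvd m - 1" "int N dvd k - 1"
    "of_int m \<in> M" "\<forall>x\<in>M. of_int k * x \<in> OK d"
    using assms by (auto simp: IK_iff)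
  have "of_int m * x \<in> OK d" if "x \<in> W" for x using ideal_multI[OF m(5) that] W(2) by simp
  moreover have "of_int k \<in> W"
  proof -
    have "ideal_mult d M W \<subseteq> {x. \<forall>y\<in>{of_int k}. x * y \<in> W}"
    proof (intro ideal_mult_least omod_quotient frac_ideal_omod W CollectI ballI)
      fix x y z :: complex assume xy: "x \<in> M" "y \<in> W" and "z \<in> {of_int k}"
      then have eq: "x * y * z = (of_int k * x) * y" by (simp add: ac_simps)
      show "x * y * z \<in> W"
        unfolding eq by (rule omodD(3)[OF frac_ideal_omod[OF W(1)]]) (use m(6) xy in auto)
    qed
    \<comment> \<open>1 lies in M W and k M lies in O_K, so k lies in (k M) W, which is contained in
      W.\<close>
    then have "1 \<in> {x. \<forall>y\<in>{of_int k}. x * y \<in> W}" unfolding W(2) by (rule subsetD) simp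
    then show ?thesis by simp
  qed
  ultimately have "W \<in> IK d N" unfolding IK_iff[OF assms(1)] using W(1) m by blast
  then show ?thesis using that W(2) by blast
qed

lemma comm_group_IK:
  assumes "N > 0"
  shows "comm_group (IK_group d N)"
proof (rule comm_groupI)
  fix M assume "M \<in> carrier (IK_group d N)"
  then obtain W where "W \<in> IK d N" "ideal_mult d W M = OK d"
    using IK_inverse[OF assms] ideal_mult_comm by (metis IK_group_def partial_object.select_convs(1))
  then show "\<exists>W\<in>carrier (IK_group d N). W \<otimes>\<^bsub>IK_group d N\<^esub> M = \<one>\<^bsub>IK_group d N\<^esub>"
    by (auto simp: IK_group_def)
qed (simp_all add: IK_group_def IK_mult IK_OK assms ideal_mult_assoc
      ideal_mult_OK frac_ideal_omod IK_frac, rule ideal_mult_comm)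

end

section \<open>The modular group and its action on forms\<close>

lemma mat2_mult: "(A ** B) $ i $ j = A $ i $ 1 * B $ 1 $ j + A $ i $ 2 * B $ 2 $ j"
  for A B :: "int^2^2"
  by (simp add: matrix_matrix_mult_def sum_2)

lemma sl2_inv_nth [simp]:
  "sl2_inv A $ 1 $ 1 = A $ 2 $ 2" "sl2_inv A $ 1 $ 2 = - A $ 1 $ 2"
  "sl2_inv A $ 2 $ 1 = - A $ 2 $ 1" "sl2_inv A $ 2 $ 2 = A $ 1 $ 1"
  by (simp_all add: sl2_inv_def)

lemma sl2_inv_inv [simp]: "sl2_inv (sl2_inv A) = A"
  by (simp add: vec_eq_iff forall_2)

lemma SL2Z_iff: "A \<in> carrier SL2Z \<longleftrightarrow> A $ 1 $ 1 * A $ 2 $ 2 - A $ 1 $ 2 * A $ 2 $ 1 = 1"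
  by (simp add: SL2Z_def det_2)

lemma SL2Z_mult [simp]: "A \<otimes>\<^bsub>SL2Z\<^esub> B = A ** B" and SL2Z_one [simp]: "\<one>\<^bsub>SL2Z\<^esub> = mat 1"
  by (simp_all add: SL2Z_def)

lemma sl2_inv_left: "A \<in> carrier SL2Z \<Longrightarrow> sl2_inv A ** A = mat 1"
  by (auto simp: SL2Z_iff vec_eq_iff forall_2 mat2_mult mat_def algebra_simps)

lemma sl2_inv_closed: "A \<in> carrier SL2Z \<Longrightarrow> sl2_inv A \<in> carrier SL2Z"
  by (simp add: SL2Z_iff mult.commute)

interpretation SL2Z: group SL2Z
proof (rule groupI)
  fix A assume "A \<in> carrier SL2Z"
  then show "\<exists>B\<in>carrier SL2Z. B \<otimes>\<^bsub>SL2Z\<^esub> A = \<one>\<^bsub>SL2Z\<^esub>"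
    using sl2_inv_left sl2_inv_closed by auto
qed (auto simp: SL2Z_def det_mul matrix_mul_assoc)

lemma inv_SL2Z: "A \<in> carrier SL2Z \<Longrightarrow> inv\<^bsub>SL2Z\<^esub> A = sl2_inv A"
  by (rule SL2Z.inv_equality) (auto simp: sl2_inv_left sl2_inv_closed)

lemma jfac_nonzero:
  assumes "A \<in> carrier SL2Z" "Im w > 0" shows "jfac A w \<noteq> 0"
proof
  assume "jfac A w = 0"
  then have "of_int (A $ 2 $ 1) * w + of_int (A $ 2 $ 2) = of_int 0 * w + of_int 0"
    by (simp add: jfac_def)
  from lin_indep_Im[OF _ this] assms(2) have "A $ 2 $ 1 = 0" "A $ 2 $ 2 = 0" by auto
  then show False using assms(1) by (simp add: SL2Z_iff)
qed

lemma moebius_jfac: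
  assumes "A \<in> carrier SL2Z" "Im w > 0"
  shows "moebius A w * jfac A w = of_int (A $ 1 $ 1) * w + of_int (A $ 1 $ 2)"
  using jfac_nonzero[OF assms] by (simp add: moebius_def)

lemma Im_moebius_pos:
  assumes "A \<in> carrier SL2Z" "Im w > 0" shows "Im (moebius A w) > 0"
proof -
  have "Im (moebius A w) = Im w / (cmod (jfac A w))\<^sup>2"
    using Im_moebius[OF jfac_nonzero[OF assms, unfolded jfac_def], of "A $ 1 $ 1" "A $ 1 $ 2"] assms(1)
    by (simp only: SL2Z_iff moebius_def jfac_def of_int_1 mult_1)
  then show ?thesis using assms jfac_nonzero[OF assms] by simp
qed

lemma jfac_mult:
  assumes "B \<in> carrier SL2Z" "Im w > 0"
  shows "jfac (A ** B) w = jfac A (moebius B w) * jfac B w"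
  using moebius_jfac[OF assms]
  by (simp add: jfac_def[of A] jfac_def[of "A ** B"] distrib_right mult.assoc mat2_mult)
     (simp add: jfac_def algebra_simps)

lemma moebius_mult:
  assumes "A \<in> carrier SL2Z" "B \<in> carrier SL2Z" "Im w > 0"
  shows "moebius (A ** B) w = moebius A (moebius B w)"
proof -
  have AB: "A ** B \<in> carrier SL2Z" using SL2Z.m_closed[OF assms(1,2)] by simp
  have "moebius (A ** B) w * jfac (A ** B) w =
        of_int (A $ 1 $ 1) * (moebius B w * jfac B w) + of_int (A $ 1 $ 2) * jfac B w"
    unfolding moebius_jfac[OF AB assms(3)] moebius_jfac[OF assms(2,3)]
    by (simp add: mat2_mult jfac_def algebra_simps)
  also have "\<dots> = (moebius A (moebius B w) * jfac A (moebius B w)) * jfac B w"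
    unfolding moebius_jfac[OF assms(1) Im_moebius_pos[OF assms(2,3)]]
    by (simp add: algebra_simps)
  also have "\<dots> = moebius A (moebius B w) * jfac (A ** B) w"
    unfolding jfac_mult[OF assms(2,3)] by simp
  finally show ?thesis using jfac_nonzero[OF AB assms(3)] by simp
qed

lemma moebius_one: "moebius (mat 1) w = w"
  by (simp add: moebius_def jfac_def mat_def)

lemma moebius_inv:
  assumes "A \<in> carrier SL2Z" "Im w > 0" shows "moebius (sl2_inv A) (moebius A w) = w"
  using moebius_mult[OF sl2_inv_closed[OF assms(1)] assms]
  by (simp add: sl2_inv_left assms moebius_one)

text \<open>For g in \<Gamma>, the matrix g^-1 \<gamma> fixes w exactly when g and \<gamma> send w
  to the same point. This turns the right side of property (P) into a statement about
  \<Gamma>-orbits of points.\<close>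

lemma mem_subgroup_isotropy_iff:
  assumes "subgroup \<Gamma> SL2Z" "\<gamma> \<in> carrier SL2Z" "Im w > 0"
  shows "\<gamma> \<in> \<Gamma> <#>\<^bsub>SL2Z\<^esub> isotropy w \<longleftrightarrow> (\<exists>g\<in>\<Gamma>. moebius \<gamma> w = moebius g w)"
proof
  assume "\<gamma> \<in> \<Gamma> <#>\<^bsub>SL2Z\<^esub> isotropy w"
  then obtain g i where "g \<in> \<Gamma>" "i \<in> carrier SL2Z" "moebius i w = w" "\<gamma> = g ** i"
    by (auto simp: set_mult_def isotropy_def)
  then show "\<exists>g\<in>\<Gamma>. moebius \<gamma> w = moebius g w"
    using moebius_mult[of g i w] subgroup.subset[OF assms(1)] assms(3) by auto
next
  assume "\<exists>g\<in>\<Gamma>. moebius \<gamma> w = moebius g w"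
  then obtain g where g: "g \<in> \<Gamma>" "moebius \<gamma> w = moebius g w" by blast
  have gc: "g \<in> carrier SL2Z" using g(1) subgroup.subset[OF assms(1)] by blast
  define i where "i = sl2_inv g ** \<gamma>"
  have "i \<in> carrier SL2Z"
    using SL2Z.m_closed[OF sl2_inv_closed[OF gc] assms(2)] by (simp add: i_def)
  moreover have "moebius i w = w"
    unfolding i_def moebius_mult[OF sl2_inv_closed[OF gc] assms(2,3)] g(2)
    by (rule moebius_inv[OF gc assms(3)])
  moreover have "g ** i = \<gamma>"
    using SL2Z.r_inv[OF gc] inv_SL2Z[OF gc] by (simp add: i_def matrix_mul_assoc)
  ultimately show "\<gamma> \<in> \<Gamma> <#>\<^bsub>SL2Z\<^esub> isotropy w"
    using g(1) by (auto simp: set_mult_def isotropy_def)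
qed

text \<open>The unimodular basis change by A replaces (w, 1) by j(A, w) times (A w, 1).\<close>

lemma latt_moebius:
  assumes "A \<in> carrier SL2Z" "Im w > 0"
  shows "latt w = (*) (jfac A w) ` latt (moebius A w)"
proof -
  have "latt w = zlat (of_int (A $ 1 $ 1) * w + of_int (A $ 1 $ 2) * 1)
                      (of_int (A $ 2 $ 1) * w + of_int (A $ 2 $ 2) * 1)"
    unfolding latt_eq_zlat using assms(1) by (intro zlat_basis_change[symmetric]) (simp add: SL2Z_iff)
  also have "\<dots> = zlat (jfac A w * moebius A w) (jfac A w * 1)"
    using moebius_jfac[OF assms] by (simp add: jfac_def mult.commute)
  finally show ?thesis by (simp add: latt_eq_zlat zlat_scale)
qed

text \<open>The lower row of the transition matrix expresses the ratio itself in the basis (w, 1),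
  which makes it an automorphy factor.\<close>

lemma latt_homothetic:
  assumes "Im w > 0" "Im w' > 0" "latt w = (*) \<nu> ` latt w'"
  obtains A where "A \<in> carrier SL2Z" "\<nu> = jfac A w" "w' = moebius A w"
proof -
  have "zlat w 1 = zlat (\<nu> * w') \<nu>" using assms(3) by (simp add: latt_eq_zlat zlat_scale)
  from zlat_homothetic[OF assms(1,2) this] obtain p q r s :: int where
    *: "p * s - q * r = 1" "\<nu> = of_int r * w + of_int s" "\<nu> * w' = of_int p * w + of_int q" .
  define A :: "int^2^2" where "A = vector [vector [p, q], vector [r, s]]"
  have A: "A \<in> carrier SL2Z" using *(1) by (simp add: SL2Z_iff A_def)
  moreover have \<nu>: "\<nu> = jfac A w" using *(2) by (simp add: jfac_def A_def)
  moreover have "w' * jfac A w = moebius A w * jfac A w"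
    unfolding moebius_jfac[OF A assms(1)] using *(3) by (simp add: \<nu>[symmetric] mult.commute) (simp add: A_def)
  then have "w' = moebius A w" using jfac_nonzero[OF A assms(1)] by simp
  ultimately show ?thesis using that by blast
qed

section \<open>Forms and their roots under SL_2(Z)\<close>

context imag_quad_field
begin

lemma form_act_Qd:
  assumes "Q \<in> Qd d" "A \<in> carrier SL2Z"
  shows "form_act Q A \<in> Qd d"
proof -
  obtain a b c where Q: "Q = (a, b, c)" by (cases Q)
  obtain p q r t where A: "p = A$1$1" "q = A$1$2" "r = A$2$1" "t = A$2$2" by simp
  have a: "a > 0" and d: "b\<^sup>2 - 4 * a * c = d" using assms(1) by (auto simp: Q Qd_iff)
  have det: "p * t - q * r = 1" using assms(2) by (simp add: SL2Z_iff A)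
  define a' where "a' = a * p\<^sup>2 + b * p * r + c * r\<^sup>2"
  define b' where "b' = 2 * a * p * q + b * (p * t + q * r) + 2 * c * r * t"
  define c' where "c' = a * q\<^sup>2 + b * q * t + c * t\<^sup>2"
  have "b'\<^sup>2 - 4 * a' * c' = (b\<^sup>2 - 4 * a * c) * (p * t - q * r)\<^sup>2"
    unfolding a'_def b'_def c'_def by (simp add: power2_eq_square algebra_simps)
  then have "b'\<^sup>2 - 4 * a' * c' = d" by (simp add: det d)
  moreover have "a' > 0"
  proof -
    \<comment> \<open>Completing the square: with negative discriminant both terms are nonnegative,
      and they vanish together only for p = r = 0, which the determinant excludes.\<close>
    have "4 * a * a' = (2 * a * p + b * r)\<^sup>2 - (b\<^sup>2 - 4 * a * c) * r\<^sup>2"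
      unfolding a'_def by (simp add: power2_eq_square algebra_simps)
    also have "\<dots> > 0"
    proof (cases "r = 0")
      case True
      then have "p \<noteq> 0" using det by auto
      then show ?thesis using True a by simp
    next
      case False
      then have "d * r\<^sup>2 < 0" using d_neg by (simp add: mult_neg_pos)
      then show ?thesis unfolding d by (smt (verit) zero_le_power2)
    qed
    finally show ?thesis using a by (simp add: zero_less_mult_iff)
  qed
  moreover have "form_act Q A = (a', b', c')"
    by (simp add: Q form_act_def Let_def A[symmetric] a'_def b'_def c'_def)
  ultimately show ?thesis by (simp add: Qd_iff)
qed

text \<open>4a times the quadratic factors as (2av + b - sqrt d)(2av + b + sqrt d). The second
  factor has positive imaginary part, so the first one vanishes.\<close>

lemma omega_unique:
  assumes "(a, b, c) \<in> Qd d" "Im v > 0" "of_int a * (v * v) + of_int b * v + of_int c = 0"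
  shows "omega d (a, b, c) = v"
proof -
  have a: "a > 0" and d: "b\<^sup>2 - 4 * a * c = d" using assms(1) by (auto simp: Qd_iff)
  have "of_int d = of_int b * of_int b - 4 * of_int a * (of_int c :: complex)"
    unfolding d[symmetric] by (simp add: power2_eq_square)
  with assms(3) sqrtD_sq have
    "(2 * of_int a * v + of_int b - sqrtD d) * (2 * of_int a * v + of_int b + sqrtD d) = 0"
    by algebra
  moreover have "Im (2 * of_int a * v + of_int b + sqrtD d) > 0"
    using a assms(2) by (simp add: add_pos_pos)
  then have "2 * of_int a * v + of_int b + sqrtD d \<noteq> 0" by (metis less_irrefl zero_complex.sel(2))
  ultimately have "2 * of_int a * v + of_int b - sqrtD d = 0" by (metis mult_eq_0_iff)
  then have "2 * of_int a * v = - of_int b + sqrtD d" by algebra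
  then have "2 * of_int a * v = 2 * of_int a * omega d (a, b, c)" using omega_mult[OF a] by simp
  then show ?thesis using a by simp
qed

text \<open>The vector A (w, 1) equals j(A, w) times (v, 1) with v = A w. The transformed form takes
  on it the value Q(w, 1) = 0, and homogeneity makes v a root.\<close>

lemma omega_form_act:
  assumes "Q \<in> Qd d" "A \<in> carrier SL2Z"
  shows "omega d (form_act Q (sl2_inv A)) = moebius A (omega d Q)"
proof -
  obtain a b c where Q: "Q = (a, b, c)" by (cases Q)
  obtain p q r t where A: "p = A$1$1" "q = A$1$2" "r = A$2$1" "t = A$2$2" by simp
  define w where "w = omega d Q"
  define v where "v = moebius A w"
  have w: "Im w > 0" using Im_omega assms(1) by (simp add: w_def)
  have root: "of_int a * (w * w) = - of_int b * w - of_int c"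
    using omega_root assms(1) by (simp add: Q w_def)
  have j: "jfac A w \<noteq> 0" by (rule jfac_nonzero[OF assms(2) w])
  have jj: "jfac A w = of_int r * w + of_int t" by (simp add: jfac_def A)
  have vj: "v * jfac A w = of_int p * w + of_int q"
    using moebius_jfac[OF assms(2) w] by (simp add: v_def A)
  have det: "of_int p * of_int t - of_int q * of_int r = (1 :: complex)"
    using arg_cong[of _ _ "of_int :: int \<Rightarrow> complex", OF assms(2)[unfolded SL2Z_iff]] by (simp add: A)
  define a' where "a' = a * t\<^sup>2 + b * t * (- r) + c * (- r)\<^sup>2"
  define b' where "b' = 2 * a * t * (- q) + b * (t * p + (- q) * (- r)) + 2 * c * (- r) * p"
  define c' where "c' = a * (- q)\<^sup>2 + b * (- q) * p + c * p\<^sup>2"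
  have act: "form_act Q (sl2_inv A) = (a', b', c')"
    by (simp add: Q form_act_def Let_def A[symmetric] a'_def b'_def c'_def)
  let ?X = "of_int p * w + of_int q" and ?Y = "of_int r * w + of_int t"
  have "of_int t * ?X - of_int q * ?Y = (of_int p * of_int t - of_int q * of_int r) * w"
    by (simp add: algebra_simps)
  then have X: "of_int t * ?X - of_int q * ?Y = w" by (simp add: det)
  have "of_int p * ?Y - of_int r * ?X = of_int p * of_int t - of_int q * of_int r"
    by (simp add: algebra_simps)
  then have Y: "of_int p * ?Y - of_int r * ?X = 1" by (simp add: det)
  have "(of_int a' * (v * v) + of_int b' * v + of_int c') * (jfac A w * jfac A w) =
        of_int a' * (v * jfac A w) * (v * jfac A w) + of_int b' * (v * jfac A w) * jfac A w +
        of_int c' * (jfac A w * jfac A w)"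
    by (simp add: algebra_simps)
  also have "\<dots> = of_int a' * (?X * ?X) + of_int b' * ?X * ?Y + of_int c' * (?Y * ?Y)"
    by (simp only: vj) (simp only: jj mult.assoc)
  \<comment> \<open>The definition of a', b', c' as the coefficients of Q after the substitution by
    the inverse matrix.\<close>
  also have "\<dots> = of_int a * ((of_int t * ?X - of_int q * ?Y) * (of_int t * ?X - of_int q * ?Y)) +
      of_int b * (of_int t * ?X - of_int q * ?Y) * (of_int p * ?Y - of_int r * ?X) +
      of_int c * ((of_int p * ?Y - of_int r * ?X) * (of_int p * ?Y - of_int r * ?X))"
    unfolding a'_def b'_def c'_def of_int_add of_int_mult of_int_power of_int_minus of_int_numeral
    by algebra
  also have "\<dots> = 0" unfolding X Y by (simp add: root)
  finally have "of_int a' * (v * v) + of_int b' * v + of_int c' = 0" using j by simp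
  moreover have "(a', b', c') \<in> Qd d"
    using form_act_Qd[OF assms(1) sl2_inv_closed[OF assms(2)]] by (simp add: act)
  moreover have "Im v > 0" using Im_moebius_pos[OF assms(2) w] by (simp add: v_def)
  ultimately have "omega d (a', b', c') = v" by (intro omega_unique)
  then show ?thesis by (simp add: act v_def w_def)
qed

text \<open>The right action on forms becomes the inverse matrix acting on roots, and \<Gamma> is
  closed under inverses. Injectivity of the root map allows the passage back to forms.\<close>

lemma form_rel_iff:
  assumes "subgroup \<Gamma> SL2Z"
  shows "(Q, Q') \<in> form_rel d N \<Gamma> \<longleftrightarrow> Q \<in> QN d N \<and> Q' \<in> QN d N \<and>
    (\<exists>g\<in>\<Gamma>. omega d Q' = moebius g (omega d Q))"
proof safe
  assume "(Q, Q') \<in> form_rel d N \<Gamma>"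
  then obtain g where g: "Q \<in> QN d N" "Q' \<in> QN d N" "g \<in> \<Gamma>" "Q' = form_act Q g"
    by (auto simp: form_rel_def)
  then have gc: "g \<in> carrier SL2Z" using subgroup.subset[OF assms] by blast
  show "\<exists>g\<in>\<Gamma>. omega d Q' = moebius g (omega d Q)"
  proof
    show "sl2_inv g \<in> \<Gamma>" using subgroup.m_inv_closed[OF assms g(3)] inv_SL2Z[OF gc] by simp
    show "omega d Q' = moebius (sl2_inv g) (omega d Q)"
      using omega_form_act[OF QN_Qd[OF g(1)] sl2_inv_closed[OF gc]] g(4) by simp
  qed
next
  fix g assume g: "Q \<in> QN d N" "Q' \<in> QN d N" "g \<in> \<Gamma>" "omega d Q' = moebius g (omega d Q)"
  then have gc: "g \<in> carrier SL2Z" using subgroup.subset[OF assms] by blast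
  have "Q' = form_act Q (sl2_inv g)"
    using g omega_form_act[OF QN_Qd[OF g(1)] gc]
    by (intro omega_inj QN_Qd[of Q'] form_act_Qd sl2_inv_closed gc) (auto intro: QN_Qd)
  moreover have "sl2_inv g \<in> \<Gamma>" using subgroup.m_inv_closed[OF assms g(3)] inv_SL2Z[OF gc] by simp
  ultimately show "(Q, Q') \<in> form_rel d N \<Gamma>" using g(1,2) by (auto simp: form_rel_def)
qed (auto simp: form_rel_def)

lemma equiv_form_rel:
  assumes "subgroup \<Gamma> SL2Z"
  shows "equiv (QN d N) (form_rel d N \<Gamma>)"
proof (rule equivI)
  note iff = form_rel_iff[OF assms]
  show "form_rel d N \<Gamma> \<subseteq> QN d N \<times> QN d N" by (auto simp: form_rel_def)
  show "refl_on (QN d N) (form_rel d N \<Gamma>)"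
    using subgroup.one_closed[OF assms] by (auto simp: refl_on_def iff intro!: bexI moebius_one[symmetric])
  show "sym (form_rel d N \<Gamma>)"
  proof (rule symI)
    fix Q Q' assume "(Q, Q') \<in> form_rel d N \<Gamma>"
    then obtain g where g: "Q \<in> QN d N" "Q' \<in> QN d N" "g \<in> \<Gamma>" "omega d Q' = moebius g (omega d Q)"
      by (auto simp: iff)
    then have gc: "g \<in> carrier SL2Z" using subgroup.subset[OF assms] by blast
    have "omega d Q = moebius (sl2_inv g) (omega d Q')"
      unfolding g(4) using moebius_inv[OF gc Im_omega[OF QN_Qd[OF g(1)]]] by simp
    moreover have "sl2_inv g \<in> \<Gamma>" using subgroup.m_inv_closed[OF assms g(3)] inv_SL2Z[OF gc] by simp
    ultimately show "(Q', Q) \<in> form_rel d N \<Gamma>" using g(1,2) by (auto simp: iff)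
  qed
  show "trans (form_rel d N \<Gamma>)"
  proof (rule transI)
    fix Q Q' Q'' assume "(Q, Q') \<in> form_rel d N \<Gamma>" "(Q', Q'') \<in> form_rel d N \<Gamma>"
    then obtain g h where g: "Q \<in> QN d N" "Q'' \<in> QN d N" "g \<in> \<Gamma>" "h \<in> \<Gamma>"
      "omega d Q' = moebius g (omega d Q)" "omega d Q'' = moebius h (omega d Q')"
      by (auto simp: iff)
    then have gc: "g \<in> carrier SL2Z" "h \<in> carrier SL2Z" using subgroup.subset[OF assms] by blast+
    have "omega d Q'' = moebius (h ** g) (omega d Q)"
      using moebius_mult[OF gc(2,1) Im_omega[OF QN_Qd[OF g(1)]]] g by simp
    moreover have "h ** g \<in> \<Gamma>" using subgroup.m_closed[OF assms g(4,3)] by simp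
    ultimately show "(Q, Q'') \<in> form_rel d N \<Gamma>" using g(1,2) by (auto simp: iff)
  qed
qed

end

section \<open>Ray classes and forms\<close>

text \<open>Surjectivity is built into the hypothesis on the image, so what remains is
  well-definedness and injectivity, the two directions of the equivalence on the right.\<close>

lemma quotient_map_bij_iff:
  assumes R: "equiv S R" and f: "f ` S = C"
  shows "(\<forall>(x, y)\<in>R. f x = f y) \<and> bij_betw (\<lambda>X. the_elem (f ` X)) (S // R) C \<longleftrightarrow>
    (\<forall>x\<in>S. \<forall>y\<in>S. f x = f y \<longleftrightarrow> (x, y) \<in> R)"
proof -
  let ?\<phi> = "\<lambda>X. the_elem (f ` X)"
  have RS: "R \<subseteq> S \<times> S" using R by (simp add: equiv_def)
  have \<phi>: "?\<phi> (R `` {x}) = f x" if "\<forall>(x, y)\<in>R. f x = f y" "x \<in> S" for x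
  proof -
    have "f ` (R `` {x}) = {f x}" using that equiv_class_self[OF R that(2)] by force
    then show ?thesis by simp
  qed
  show ?thesis
  proof safe
    fix x y
    assume inv: "\<forall>(x, y)\<in>R. f x = f y" and bij: "bij_betw ?\<phi> (S // R) C"
      and xy: "x \<in> S" "y \<in> S"
    {
      assume "f x = f y"
      then have "?\<phi> (R `` {x}) = ?\<phi> (R `` {y})" using \<phi>[OF inv] xy by simp
      then have "R `` {x} = R `` {y}"
        using bij xy quotientI[of _ S R] by (auto simp: bij_betw_def inj_on_def)
      then show "(x, y) \<in> R" using eq_equiv_class[OF _ R xy(2)] by blast
    }
    assume "(x, y) \<in> R"
    then show "f x = f y" using inv by auto
  next
    fix x y assume "\<forall>x\<in>S. \<forall>y\<in>S. f x = f y \<longleftrightarrow> (x, y) \<in> R" "(x, y) \<in> R"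
    then show "f x = f y" using RS by auto
  next
    assume *: "\<forall>x\<in>S. \<forall>y\<in>S. f x = f y \<longleftrightarrow> (x, y) \<in> R"
    then have inv: "\<forall>(x, y)\<in>R. f x = f y" using RS by auto
    show "bij_betw ?\<phi> (S // R) C"
      unfolding bij_betw_def
    proof
      show "inj_on ?\<phi> (S // R)"
      proof (rule inj_onI, elim quotientE)
        fix X Y x y assume "X = R `` {x}" "Y = R `` {y}" "x \<in> S" "y \<in> S" "?\<phi> X = ?\<phi> Y"
        then show "X = Y" using * \<phi>[OF inv] equiv_class_eq[OF R] by metis
      qed
      show "?\<phi> ` (S // R) = C"
        unfolding f[symmetric] quotient_def using \<phi>[OF inv] by (force simp: image_iff)
    qed
  qed
qed

lemma (in group) transport_iso:
  fixes f :: "'c \<Rightarrow> 'a"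
  assumes "bij_betw f S (carrier G)"
  obtains H :: "'c monoid" where "group H" "carrier H = S" "f \<in> iso H G"
proof -
  define g where "g = the_inv_into S f"
  define H where "H = \<lparr>carrier = S, monoid.mult = \<lambda>x y. g (f x \<otimes> f y), one = g \<one>\<rparr>"
  have inj: "inj_on f S" and im: "f ` S = carrier G" using assms by (auto simp: bij_betw_def)
  have fg: "f (g y) = y" if "y \<in> carrier G" for y
    unfolding g_def using that im by (intro f_the_inv_into_f[OF inj]) auto
  have gS: "g y \<in> S" if "y \<in> carrier G" for y
    unfolding g_def using that im by (intro the_inv_into_into[OF inj]) auto
  have fS: "f x \<in> carrier G" if "x \<in> S" for x using that im by blast
  have "g \<in> iso G H"
    using bij_betw_the_inv_into[OF assms] gS by (auto simp: iso_def hom_def H_def g_def[symmetric] fg)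
  \<comment> \<open>The library fact resets the unit to the image of the unit of \<open>G\<close>;
    \<open>H\<close> was defined with exactly that unit, so nothing changes.\<close>
  then have "group (H \<lparr>one := g \<one>\<rparr>)" by (rule iso_imp_img_group)
  then have "group H" by (simp add: H_def)
  moreover have "carrier H = S" by (simp add: H_def)
  moreover have "f \<in> iso H G" using assms fS fg by (auto simp: iso_def hom_def H_def)
  ultimately show ?thesis by (rule that)
qed

section \<open>Classes modulo P of the lattices of forms\<close>

locale ray_class_subgroup = imag_quad_field +
  fixes N :: nat and P :: "complex set set"
  assumes N: "N > 0"
    and P_subgroup: "subgroup P (IK_group d N)"
    and P_lower: "PK1 d N \<subseteq> P" and P_upper: "P \<subseteq> PK d N"
begin

sublocale IK: comm_group "IK_group d N"
  by (rule comm_group_IK[OF N])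

abbreviation cls :: "complex set \<Rightarrow> complex set set" where
  "cls M \<equiv> P #>\<^bsub>IK_group d N\<^esub> M"

lemma carrier_IK [simp]: "carrier (IK_group d N) = IK d N"
  and mult_IK [simp]: "M \<otimes>\<^bsub>IK_group d N\<^esub> M' = ideal_mult d M M'"
  by (simp_all add: IK_group_def)

text \<open>The lattice contains 1 and is carried into O_K by a. As a is prime to N, some positive
  multiple of a is congruent to 1, and this is the integer clearing denominators.\<close>

lemma latt_IK:
  assumes "Q \<in> QN d N" shows "latt (omega d Q) \<in> IK d N"
proof -
  obtain a b c where abc: "Q = (a, b, c)" by (cases Q)
  have Q: "(a, b, c) \<in> Qd d" and cop: "coprime (int N) a"
    using assms by (auto simp: abc QN_iff)
  have a: "a > 0" using Q by (simp add: Qd_iff)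
  let ?w = "omega d (a, b, c)"
  obtain u v where uv: "u * a + v * int N = 1"
    using bezout_int[of a "int N"] cop by (auto simp: coprime_iff_gcd_eq_1 gcd.commute)
  \<comment> \<open>The Bezout inverse of \<open>a\<close> modulo N, shifted by a multiple of N
    large enough to make it positive.\<close>
  define u' where "u' = u + int N * (\<bar>u\<bar> + 1)"
  have "\<bar>u\<bar> + 1 \<le> int N * (\<bar>u\<bar> + 1)" using N mult_right_mono[of 1 "int N" "\<bar>u\<bar> + 1"] by simp
  then have u': "u' > 0" unfolding u'_def by linarith
  have "u' * a - 1 = int N * ((\<bar>u\<bar> + 1) * a - v)"
    unfolding u'_def using uv by (simp add: algebra_simps)
  then have dvd: "int N dvd u' * a - 1" by simp
  obtain h where h: "theta = of_int a * ?w + of_int h" using theta_omega[OF Q] by blast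
  then have aw: "of_int a * ?w \<in> OK d" by (metis OK_diff OK_of_int OK_theta add_diff_cancel_right')
  have "of_int (u' * a) * x \<in> OK d" if x: "x \<in> latt ?w" for x
  proof -
    obtain m n where "x = of_int m * ?w + of_int n * 1"
      using x unfolding latt_eq_zlat by (rule zlatE)
    then have "of_int (u' * a) * x = of_int (u' * m) * (of_int a * ?w) + of_int (u' * a * n)"
      by (simp add: algebra_simps)
    then show ?thesis using aw OK_add OK_mult OK_of_int by presburger
  qed
  moreover have "of_int 1 \<in> latt ?w" unfolding latt_eq_zlat using zlat_right by simp
  moreover have "u' * a > 0" using u' a by simp
  moreover have "(0 :: int) < 1" "int N dvd 1 - 1" by simp_all
  ultimately show ?thesis
    unfolding IK_iff[OF N] abc using frac_ideal_latt[OF Q] dvd by blast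
qed

text \<open>Every member of P is principal because P lies in P_K(n), so multiplying by it is a
  homothety.\<close>

lemma cls_eq_iff:
  assumes "M \<in> IK d N" "M' \<in> IK d N"
  shows "cls M = cls M' \<longleftrightarrow> (\<exists>\<nu>. \<nu> \<noteq> 0 \<and> principal d \<nu> \<in> P \<and> M = (*) \<nu> ` M')"
proof
  note M' = frac_ideal_omod[OF IK_frac[OF assms(2)]]
  {
    assume "cls M = cls M'"
    then have "M \<in> cls M'" using IK.rcos_self[OF _ P_subgroup, of M] assms by simp
    then obtain p where p: "p \<in> P" "M = ideal_mult d p M'" by (auto simp: r_coset_def)
    then obtain \<nu> where "p = principal d \<nu>" "\<nu> \<noteq> 0" using P_upper by (auto simp: PK_def)
    then show "\<exists>\<nu>. \<nu> \<noteq> 0 \<and> principal d \<nu> \<in> P \<and> M = (*) \<nu> ` M'"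
      using p ideal_mult_principal[OF M'] by auto
  }
  assume "\<exists>\<nu>. \<nu> \<noteq> 0 \<and> principal d \<nu> \<in> P \<and> M = (*) \<nu> ` M'"
  then obtain \<nu> where "principal d \<nu> \<in> P" "M = (*) \<nu> ` M'" by blast
  then have "M \<in> cls M'" using ideal_mult_principal[OF M'] by (auto simp: r_coset_def)
  then show "cls M = cls M'" using IK.repr_independence[OF _ _ P_subgroup] assms by simp
qed

lemma cls_latt_eq_iff:
  assumes "Q \<in> QN d N" "Q' \<in> QN d N"
  shows "cls (latt (omega d Q)) = cls (latt (omega d Q')) \<longleftrightarrow>
    (\<exists>\<gamma>\<in>carrier SL2Z. omega d Q' = moebius \<gamma> (omega d Q) \<and> principal d (jfac \<gamma> (omega d Q)) \<in> P)"
proof -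
  note w = Im_omega[OF QN_Qd[OF assms(1)]] and w' = Im_omega[OF QN_Qd[OF assms(2)]]
  note iff = cls_eq_iff[OF latt_IK[OF assms(1)] latt_IK[OF assms(2)]]
  show ?thesis
    unfolding iff
  proof safe
    fix \<nu> assume \<nu>: "principal d \<nu> \<in> P" "latt (omega d Q) = (*) \<nu> ` latt (omega d Q')"
    obtain A where "A \<in> carrier SL2Z" "\<nu> = jfac A (omega d Q)" "omega d Q' = moebius A (omega d Q)"
      using latt_homothetic[OF w w' \<nu>(2)] .
    then show "\<exists>\<gamma>\<in>carrier SL2Z. omega d Q' = moebius \<gamma> (omega d Q) \<and>
        principal d (jfac \<gamma> (omega d Q)) \<in> P"
      using \<nu>(1) by blast
  next
    fix \<gamma> assume "\<gamma> \<in> carrier SL2Z" "omega d Q' = moebius \<gamma> (omega d Q)"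
      "principal d (jfac \<gamma> (omega d Q)) \<in> P"
    then show "\<exists>\<nu>. \<nu> \<noteq> 0 \<and> principal d \<nu> \<in> P \<and> latt (omega d Q) = (*) \<nu> ` latt (omega d Q')"
      using latt_moebius[OF _ w] jfac_nonzero[OF _ w] by metis
  qed
qed

text \<open>Multiplication by an inverse ideal of M turns both sides into principal ideals.\<close>

lemma scale_latt_cancel:
  assumes "M \<in> IK d N" "(*) \<nu> ` M = (*) \<mu> ` M"
  shows "principal d \<nu> = principal d \<mu>"
proof -
  obtain W where "ideal_mult d M W = OK d" using IK_inverse[OF N assms(1)] .
  then show ?thesis
    using assms(2) ideal_mult_scale[of \<nu> M W] ideal_mult_scale[of \<mu> M W]
    by (simp add: principal_eq)
qed

text \<open>Replaces "some matrix" by the given one: any A with the same effect on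
  \<open>omega d Q\<close> rescales the same lattice to the same lattice, so by cancellation it has
  the same principal ideal.\<close>

lemma cls_latt_eq_moebius_iff:
  assumes "Q \<in> QN d N" "Q' \<in> QN d N" "\<gamma> \<in> carrier SL2Z" "omega d Q' = moebius \<gamma> (omega d Q)"
  shows "cls (latt (omega d Q)) = cls (latt (omega d Q')) \<longleftrightarrow> principal d (jfac \<gamma> (omega d Q)) \<in> P"
proof
  note w = Im_omega[OF QN_Qd[OF assms(1)]]
  assume "cls (latt (omega d Q)) = cls (latt (omega d Q'))"
  then obtain A where A: "A \<in> carrier SL2Z" "omega d Q' = moebius A (omega d Q)"
    "principal d (jfac A (omega d Q)) \<in> P"
    using cls_latt_eq_iff[OF assms(1,2)] by blast
  have "(*) (jfac \<gamma> (omega d Q)) ` latt (omega d Q') = (*) (jfac A (omega d Q)) ` latt (omega d Q')"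
    using latt_moebius[OF assms(3) w] latt_moebius[OF A(1) w] assms(4) A(2) by metis
  from scale_latt_cancel[OF latt_IK[OF assms(2)] this] A(3)
  show "principal d (jfac \<gamma> (omega d Q)) \<in> P" by simp
qed (use cls_latt_eq_iff[OF assms(1,2)] assms(3,4) in blast)

text \<open>The form Q^(\<gamma>^-1) is the one with root \<gamma> \<omega>, so the pairs tested by
  property (P) are those whose roots lie in one SL_2(Z)-orbit. On them the two sides read as
  equality of classes and as \<Gamma>-equivalence.\<close>

lemma property_P_iff:
  assumes "subgroup \<Gamma> SL2Z"
  shows "property_P d N P \<Gamma> \<longleftrightarrow> (\<forall>Q\<in>QN d N. \<forall>Q'\<in>QN d N.
    cls (latt (omega d Q)) = cls (latt (omega d Q')) \<longleftrightarrow> (Q, Q') \<in> form_rel d N \<Gamma>)"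
proof -
  have eq: "principal d (jfac \<gamma> (omega d Q)) \<in> P \<longleftrightarrow>
              cls (latt (omega d Q)) = cls (latt (omega d Q'))"
           "\<gamma> \<in> \<Gamma> <#>\<^bsub>SL2Z\<^esub> isotropy (omega d Q) \<longleftrightarrow> (Q, Q') \<in> form_rel d N \<Gamma>"
    if "Q \<in> QN d N" "Q' \<in> QN d N" "\<gamma> \<in> carrier SL2Z" "omega d Q' = moebius \<gamma> (omega d Q)" for Q Q' \<gamma>
    using cls_latt_eq_moebius_iff[OF that]
      mem_subgroup_isotropy_iff[OF assms that(3) Im_omega[OF QN_Qd[OF that(1)]]]
      form_rel_iff[OF assms, of Q Q' N] that by auto
  show ?thesis
  proof
    assume P: "property_P d N P \<Gamma>"
    show "\<forall>Q\<in>QN d N. \<forall>Q'\<in>QN d N.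
      cls (latt (omega d Q)) = cls (latt (omega d Q')) \<longleftrightarrow> (Q, Q') \<in> form_rel d N \<Gamma>"
    proof (intro ballI)
      fix Q Q' assume Q: "Q \<in> QN d N" "Q' \<in> QN d N"
      show "cls (latt (omega d Q)) = cls (latt (omega d Q')) \<longleftrightarrow> (Q, Q') \<in> form_rel d N \<Gamma>"
      proof (cases "\<exists>\<gamma>\<in>carrier SL2Z. omega d Q' = moebius \<gamma> (omega d Q)")
        case True
        then obtain \<gamma> where \<gamma>: "\<gamma> \<in> carrier SL2Z" "omega d Q' = moebius \<gamma> (omega d Q)" by blast
        have "form_act Q (sl2_inv \<gamma>) = Q'"
          using omega_form_act[OF QN_Qd[OF Q(1)] \<gamma>(1)] \<gamma>(2)
          by (intro omega_inj QN_Qd[OF Q(2)] form_act_Qd sl2_inv_closed \<gamma> QN_Qd[OF Q(1)]) simp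
        then show ?thesis using P Q \<gamma> eq[OF Q \<gamma>] by (auto simp: property_P_def)
      next
        \<comment> \<open>Equal classes and \<Gamma>-equivalence would each supply a matrix between
          the roots, so both sides are false.\<close>
        case False
        then show ?thesis
          using cls_latt_eq_iff[OF Q] form_rel_iff[OF assms, of Q Q' N] subgroup.subset[OF assms]
          by blast
      qed
    qed
  next
    assume *: "\<forall>Q\<in>QN d N. \<forall>Q'\<in>QN d N.
      cls (latt (omega d Q)) = cls (latt (omega d Q')) \<longleftrightarrow> (Q, Q') \<in> form_rel d N \<Gamma>"
    show "property_P d N P \<Gamma>"
      unfolding property_P_def
    proof (intro ballI impI)
      fix Q \<gamma> assume Q: "Q \<in> QN d N" "\<gamma> \<in> carrier SL2Z" "form_act Q (sl2_inv \<gamma>) \<in> QN d N"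
      from eq[OF Q(1,3,2) omega_form_act[OF QN_Qd[OF Q(1)] Q(2)]] * Q
      show "principal d (jfac \<gamma> (omega d Q)) \<in> P \<longleftrightarrow> \<gamma> \<in> \<Gamma> <#>\<^bsub>SL2Z\<^esub> isotropy (omega d Q)"
        by simp
    qed
  qed
qed

text \<open>Written as (k \<nu>)/k, the number \<nu> is a quotient of two elements of O_K that are
  both congruent to 1.\<close>

lemma PK1_I:
  assumes "\<nu> \<noteq> 0" "k > 0" "int N dvd k - 1" "t \<in> OK d" "of_int k * \<nu> = 1 + of_nat N * t"
  shows "principal d \<nu> \<in> PK1 d N"
proof -
  define \<alpha> where "\<alpha> = of_int k * \<nu>"
  obtain l where l: "k - 1 = int N * l" using assms(3) by (rule dvdE)
  have k: "of_int k = 1 + of_nat N * (of_int l :: complex)"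
    using arg_cong[OF l, of "of_int :: int \<Rightarrow> complex"] by (simp add: algebra_simps)
  have \<alpha>: "\<alpha> = 1 + of_nat N * t" using assms(5) by (simp add: \<alpha>_def)
  have NK: "of_nat N \<in> OK d" using OK_of_int[of "int N"] by simp
  have \<alpha>K: "\<alpha> \<in> OK d" unfolding \<alpha> using NK assms(4) by simp
  \<comment> \<open>An element 1 + N x is prime to N because y = (1 + N x) y - N x y for every y in
    O_K.\<close>
  have cop: "coprime_n d N (principal d (1 + of_nat N * x))" if "x \<in> OK d" for x
  proof -
    have "ideal_add (principal d (1 + of_nat N * x)) (principal d (of_nat N)) \<subseteq> OK d"
      using that NK by (auto simp: ideal_add_def principal_def)
    moreover have "y \<in> ideal_add (principal d (1 + of_nat N * x)) (principal d (of_nat N))"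
      if "y \<in> OK d" for y
    proof -
      have "y = (1 + of_nat N * x) * y + of_nat N * (of_int (- 1) * (x * y))"
        by (simp add: algebra_simps)
      moreover have "of_int (- 1) * (x * y) \<in> OK d"
        using \<open>x \<in> OK d\<close> that by (intro OK_mult OK_of_int)
      ultimately show ?thesis using that unfolding ideal_add_def principal_def by blast
    qed
    ultimately show ?thesis unfolding coprime_n_def by blast
  qed
  have "\<nu> = \<alpha> / of_int k" using assms(2) by (simp add: \<alpha>_def)
  moreover have "\<nu> \<in> Kfield d" unfolding calculation using OK_K[OF \<alpha>K] by simp
  moreover have "coprime_n d N (principal d \<alpha>)" unfolding \<alpha> by (rule cop[OF assms(4)])
  moreover have "coprime_n d N (principal d (of_int k))" unfolding k by (rule cop) simp
  moreover have "\<alpha> - of_int k = of_nat N * (t - of_int l)" by (simp add: \<alpha> k algebra_simps)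
  then have "\<alpha> - of_int k \<in> principal d (of_nat N)" using assms(4) by (auto simp: principal_def)
  moreover have "(of_int k :: complex) \<noteq> 0" using assms(2) by simp
  ultimately show ?thesis unfolding PK1_def using assms(1) \<alpha>K OK_of_int by blast
qed

text \<open>An ideal \<open>M\<close> prime to \<open>N\<close> contains an integer \<open>m \<equiv> 1\<close>; a primitive vector of \<open>M\<close> congruent
  to \<open>m\<close> modulo \<open>N M\<close> is a generator \<open>\<nu> \<equiv>\<^sup>* 1\<close> with \<open>M = \<nu> [\<omega>, 1]\<close>.\<close>

lemma IK_class_form:
  assumes "M \<in> IK d N"
  obtains Q where "Q \<in> QN d N" "cls M = cls (latt (omega d Q))"
proof -
  note fM = IK_frac[OF assms] note M = frac_ideal_omod[OF fM]
  obtain m k :: int where m: "m > 0" "k > 0" "int N dvd m - 1" "int N dvd k - 1"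
    "of_int m \<in> M" "\<forall>x\<in>M. of_int k * x \<in> OK d"
    using assms by (auto simp: IK_iff[OF N])
  obtain x y where xy: "M = zlat x y" "y \<noteq> 0" "x \<in> Kfield d" "y \<in> Kfield d" "Im (x / y) > 0"
    using frac_ideal_basis[OF fM] .
  obtain u v where uv: "of_int m = of_int u * x + of_int v * y"
    using m(5) unfolding xy(1) by (rule zlatE)
  have Mxy: "x \<in> M" "y \<in> M" unfolding xy(1) by (rule zlat_left, rule zlat_right)
  \<comment> \<open>A common factor g makes m equal to g times an element of M. After multiplication
    by k this shows that g divides k m, while k m is congruent to 1 modulo N and hence modulo
    g.\<close>
  have "gcd (gcd u v) (int N) = 1"
  proof -
    define g where "g = gcd (gcd u v) (int N)"
    have gN: "g dvd int N" by (simp add: g_def)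
    have gu: "g dvd u" "g dvd v" by (metis g_def dvd_trans gcd_dvd1, metis g_def dvd_trans gcd_dvd1 gcd_dvd2)
    obtain u' v' where u': "u = g * u'" "v = g * v'" using gu by (metis dvdE)
    have g0: "g \<noteq> 0" using N by (simp add: g_def)
    have "of_int m = of_int g * (of_int u' * x + of_int v' * y)"
      unfolding uv by (simp add: u' algebra_simps)
    moreover have "of_int u' * x + of_int v' * y \<in> M"
      unfolding xy(1) by (rule zlatI) simp
    then have "of_int k * (of_int u' * x + of_int v' * y) \<in> OK d" using m(6) by blast
    then obtain a b where ab: "of_int k * (of_int u' * x + of_int v' * y) = of_int a + of_int b * theta"
      by (rule OK_E)
    ultimately have "of_int k * of_int m = of_int g * (of_int a + of_int b * theta)"
      by (metis mult.left_commute)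
    then have "of_int (k * m) + of_int 0 * theta = of_int (g * a) + of_int (g * b) * theta"
      by (simp add: algebra_simps)
    then have "k * m = g * a" by (rule OK_lin_indep(1))
    then have "g dvd k * m" by simp
    moreover have "g dvd k * m - 1"
      by (rule dvd_trans[OF gN dvd_mult_minus_one[OF m(4,3)]])
    ultimately have "g dvd k * m - (k * m - 1)" by (rule dvd_diff)
    then have "is_unit g" by simp
    then show ?thesis by (simp add: g_def)
  qed
  then obtain u' v' where u': "int N dvd u' - u" "int N dvd v' - v" "coprime u' v'"
    using coprime_lift N by (metis of_nat_0_eq_iff less_irrefl)
  \<comment> \<open>Bezout completes the primitive vector to an oriented basis in which it stands
    second, as the future ratio.\<close>
  obtain r s where "r * u' + s * v' = gcd u' v'" using bezout_int by blast
  then have rs: "s * v' - (- r) * u' = 1" using u'(3) by (simp add: coprime_iff_gcd_eq_1 algebra_simps)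
  define \<nu> where "\<nu> = of_int u' * x + of_int v' * y"
  define x' where "x' = of_int s * x + of_int (- r) * y"
  have M_eq: "M = zlat x' \<nu>" unfolding xy(1) \<nu>_def x'_def
    by (rule zlat_basis_change[symmetric]) (use rs in simp)
  have nz: "of_int u' * (x / y) + of_int v' \<noteq> 0"
  proof
    assume "of_int u' * (x / y) + of_int v' = 0"
    then have "of_int u' * (x / y) + of_int v' = of_int 0 * (x / y) + of_int 0" by simp
    from lin_indep_Im[OF _ this] xy(5) have "u' = 0" "v' = 0" by auto
    then show False using rs by simp
  qed
  have \<nu>: "\<nu> = y * (of_int u' * (x / y) + of_int v')" using xy(2) by (simp add: \<nu>_def algebra_simps)
  then have \<nu>0: "\<nu> \<noteq> 0" using nz xy(2) by simp
  have "x' / \<nu> = (of_int s * (x / y) + of_int (- r)) / (of_int u' * (x / y) + of_int v')"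
    using xy(2) nz unfolding \<nu> x'_def by (simp add: field_simps)
  then have "Im (x' / \<nu>) = Im (x / y) / (cmod (of_int u' * (x / y) + of_int v'))\<^sup>2"
    using Im_moebius[OF nz, of s "- r"] rs by (simp only: of_int_1 mult_1)
  then have "Im (x' / \<nu>) > 0" using xy(5) nz by simp
  then obtain Q where Q: "Q \<in> Qd d" "M = (*) \<nu> ` latt (omega d Q)"
    using frac_ideal_form[OF fM M_eq \<nu>0] by metis
  obtain p q where p: "u' - u = int N * p" and q: "v' - v = int N * q" using u'(1,2) by (metis dvdE)
  \<comment> \<open>\<nu> differs from m by N \<eta>, and k clears the denominator of \<eta>; this
    is what makes k \<nu> congruent to 1 in O_K.\<close>
  define \<eta> where "\<eta> = of_int p * x + of_int q * y"
  have "\<eta> \<in> M" unfolding xy(1) \<eta>_def by (rule zlatI) simp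
  then have \<eta>: "of_int k * \<eta> \<in> OK d" using m(6) by blast
  have "\<nu> = of_int m + of_nat N * \<eta>"
  proof -
    have "u' = u + int N * p" "v' = v + int N * q" using p q by simp_all
    then show ?thesis unfolding \<nu>_def \<eta>_def uv by (simp add: algebra_simps)
  qed
  moreover obtain l where l: "k * m - 1 = int N * l"
    using dvd_mult_minus_one[OF m(4,3)] by (rule dvdE)
  have "of_int k * of_int m = 1 + of_nat N * (of_int l :: complex)"
    using arg_cong[OF l, of "of_int :: int \<Rightarrow> complex"] by (simp add: algebra_simps)
  ultimately have k\<nu>: "of_int k * \<nu> = 1 + of_nat N * (of_int l + of_int k * \<eta>)"
    by (simp add: algebra_simps)
  have \<nu>P: "principal d \<nu> \<in> P"
    using PK1_I[OF \<nu>0 m(2,4) _ k\<nu>] \<eta> P_lower by auto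
  \<comment> \<open>Dividing M by \<nu> O_K stays in I_K(n), so an integer k congruent to 1 carries
    [\<omega>, 1] into O_K. The coordinates of k \<omega> then show that a divides k, hence a is
    prime to N.\<close>
  have QN: "Q \<in> QN d N"
  proof -
    have PI: "principal d \<nu> \<in> IK d N" using \<nu>P subgroup.subset[OF P_subgroup] by auto
    obtain W where W: "W \<in> IK d N" "ideal_mult d (principal d \<nu>) W = OK d"
      using IK_inverse[OF N PI] .
    have "ideal_mult d W M = ideal_mult d (ideal_mult d (principal d \<nu>) W) (latt (omega d Q))"
      unfolding Q(2) ideal_mult_principal[OF omod_latt[OF Q(1)], symmetric]
      by (metis ideal_mult_assoc ideal_mult_comm)
    also have "\<dots> = latt (omega d Q)" unfolding W(2) by (rule ideal_mult_OK[OF omod_latt[OF Q(1)]])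
    finally have "latt (omega d Q) \<in> IK d N" using IK_mult[OF N W(1) assms] by simp
    then obtain k :: int where k: "int N dvd k - 1" "\<forall>x\<in>latt (omega d Q). of_int k * x \<in> OK d"
      unfolding IK_iff[OF N] by blast
    obtain a b c where abc: "Q = (a, b, c)" by (cases Q)
    obtain h where h: "theta = of_int a * omega d (a, b, c) + of_int h"
      using theta_omega Q(1) abc by metis
    have "omega d Q \<in> latt (omega d Q)" unfolding latt_eq_zlat by (rule zlat_left)
    then obtain e f where "of_int k * omega d Q = of_int e + of_int f * theta"
      using k(2) by (metis OK_E)
    then have "of_int k * omega d Q + of_int 0 = of_int (f * a) * omega d Q + of_int (e + f * h)"
      unfolding h abc by (simp add: algebra_simps)
    from lin_indep_Im(1)[OF _ this] have "k = f * a" using Im_omega[OF Q(1)] by auto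
    then have "gcd (int N) a dvd k" by simp
    moreover have "gcd (int N) a dvd k - 1" using k(1) by (rule dvd_trans[OF gcd_dvd1])
    ultimately have "gcd (int N) a dvd k - (k - 1)" by (rule dvd_diff)
    then have "coprime (int N) a" by (simp add: coprime_iff_gcd_eq_1)
    then show ?thesis using Q(1) by (simp add: abc QN_iff)
  qed
  have "cls M = cls (latt (omega d Q))"
    unfolding cls_eq_iff[OF assms latt_IK[OF QN]] using \<nu>0 \<nu>P Q(2) by blast
  with QN that show ?thesis by blast
qed

lemma cls_latt_image:
  "(\<lambda>Q. cls (latt (omega d Q))) ` QN d N = carrier (IK_group d N Mod P)"
proof -
  have "carrier (IK_group d N Mod P) = cls ` IK d N"
    by (auto simp: FactGroup_def RCOSETS_def)
  then show ?thesis using latt_IK IK_class_form by (auto simp: image_iff) metis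
qed

lemma bij_phi_iff:
  assumes "subgroup \<Gamma> SL2Z"
  shows "(\<forall>(Q, Q')\<in>form_rel d N \<Gamma>. cls (latt (omega d Q)) = cls (latt (omega d Q'))) \<and>
    bij_betw (phi d N P) (QN d N // form_rel d N \<Gamma>) (carrier (IK_group d N Mod P)) \<longleftrightarrow>
    property_P d N P \<Gamma>"
  unfolding property_P_iff[OF assms]
  using quotient_map_bij_iff[OF equiv_form_rel[OF assms] cls_latt_image]
  by (simp add: phi_def[abs_def])

lemma group_factor: "group (IK_group d N Mod P)"
  by (rule normal.factorgroup_is_group[OF IK.subgroup_imp_normal[OF P_subgroup]])

end

theorem theorem2p5:
  fixes dK :: int and N :: nat and P :: "complex set set" and \<Gamma> :: "(int^2^2) set"
  assumes "imag_quad_disc dK" and "N > 0"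
    and "subgroup P (IK_group dK N)"
    and "PK1 dK N \<subseteq> P" and "P \<subseteq> PK dK N"
    and "subgroup \<Gamma> SL2Z"
  shows "((((\<forall>Q \<in> QN dK N. latt (omega dK Q) \<in> IK dK N) \<and>
           (\<forall>(Q, Q') \<in> form_rel dK N \<Gamma>.
              P #>\<^bsub>IK_group dK N\<^esub> latt (omega dK Q) = P #>\<^bsub>IK_group dK N\<^esub> latt (omega dK Q'))) \<and>
          bij_betw (phi dK N P) (QN dK N // form_rel dK N \<Gamma>) (carrier (IK_group dK N Mod P)))
         \<longleftrightarrow> property_P dK N P \<Gamma>)
     \<and> (property_P dK N P \<Gamma> \<longrightarrow>
         (\<exists>H :: qform set monoid. group H \<and> carrier H = QN dK N // form_rel dK N \<Gamma> \<and>
              phi dK N P \<in> iso H (IK_group dK N Mod P)))"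
proof -
  interpret ray_class_subgroup dK N P
    by (intro ray_class_subgroup.intro imag_quad_field.intro ray_class_subgroup_axioms.intro assms)
  interpret F: group "IK_group dK N Mod P" by (rule group_factor)
  note iff = bij_phi_iff[OF assms(6)]
  show ?thesis
  proof (intro conjI impI)
    assume "property_P dK N P \<Gamma>"
    then have "bij_betw (phi dK N P) (QN dK N // form_rel dK N \<Gamma>) (carrier (IK_group dK N Mod P))"
      using iff by blast
    from F.transport_iso[OF this]
    show "\<exists>H :: qform set monoid. group H \<and> carrier H = QN dK N // form_rel dK N \<Gamma> \<and>
            phi dK N P \<in> iso H (IK_group dK N Mod P)"
      by metis
  qed (use iff latt_IK in blast)
qed

end
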